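(* For each $n\in\mathbb N$ let $S_n$ be a densely defined closed symmetric operator in a Hilbert space $\mathfrak H_n$ with equal deficiency indices, let $\Pi_n=\{\mathcal H_n,\Gamma_0^{(n)},\Gamma_1^{(n)}\}$ be a boundary triplet for $S_n^*$, and let $M_n(\cdot)$ be the corresponding Weyl function. Let $A=\bigoplus_{n=1}^\infty S_n$, $A^*=\bigoplus_{n=1}^\infty S_n^*$, and let $\Pi=\bigoplus_{n=1}^\infty\Pi_n=\{\mathcal H,\Gamma_0,\Gamma_1\}$ be the direct sum of the triplets $\Pi_n$, with $\Gamma=\{\Gamma_0,\Gamma_1\}$, $\operatorname{dom}(\Gamma)=\operatorname{dom}(\Gamma_0)\cap\operatorname{dom}(\Gamma_1)$. Then: (i) $\Pi$ forms a boundary relation for $A^*$ with single-valued $\Gamma=\{\Gamma_0,\Gamma_1\}$. (ii) The corresponding Weyl function is $M(z)=\bigoplus_{n=1}^\infty M_n(z)$. (iii) $\operatorname{ran}(\Gamma)=\operatorname{ran}(\{\Gamma_0,\Gamma_1\})$ is dense in $\mathcal H\oplus\mathcal H$. (iv) The mapping $\Gamma:\mathfrak H_+\to\mathcal H\oplus\mathcal H$ is closed and the mappings $\Gamma_j:\mathfrak H_+\to\mathcal H$, $j=0,1$, are closable. (v) If $\overline{\Gamma}_j$ denotes the closure of $\Gamma_j$, then for $j=0,1$ $$\operatorname{dom}(\overline\Gamma_j)=\mathfrak H_+\iff \overline\Gamma_j \text{ is a bounded operator from } \mathfrak H_+ \text{ to } \mathcal H\iff C_j:=\sup_{n\in\mathbb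 N}\|\Gamma_j^{(n)}\|<\infty .$$ In particular, $\operatorname{dom}(\Gamma)=\operatorname{dom}(\Gamma_0)\cap\operatorname{dom}(\Gamma_1)=\mathfrak H_+$ if and only if $\max\{C_0,C_1\}<\infty$. (vi) The operator $A_{*j}$ is essentially self-adjoint and $\overline{A_{*j}}=\widetilde A_j=\bigoplus_{n=1}^\infty S_{nj}$, $j=0,1$. (vii) Put $0':=1$, $1':=0$. For $j=0,1$, $A_{*j}$ is self-adjoint, $A_{*j}=\widetilde A_j=\bigoplus_{n=1}^\infty S_{nj}$, whenever $C_{j'}=\sup_{n\in\mathbb N}\|\Gamma_{j'}^{(n)}\|<\infty$. If in addition $\widetilde A_0$ and $\widetilde A_1$ are transversal, then $A_{*j}=(A_{*j})^*\iff C_{j'}<\infty$.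
   Context: Boundary triplet: for a densely defined closed symmetric operator $S$ in a Hilbert space $\mathfrak K$ with equal deficiency indices, a triplet $\{\mathcal G,\Gamma_0,\Gamma_1\}$ is a boundary triplet for $S^*$ if $\mathcal G$ is a Hilbert space and $\Gamma_0,\Gamma_1:\operatorname{dom}(S^* )\to\mathcal G$ are linear mappings, bounded with respect to the graph norm, such that $(S^*f,g)-(f,S^*g)=(\Gamma_1f,\Gamma_0g)_{\mathcal G}-(\Gamma_0f,\Gamma_1g)_{\mathcal G}$ for all $f,g\in\operatorname{dom}(S^* )$ and $\{\Gamma_0,\Gamma_1\}:\operatorname{dom}(S^* )\to\mathcal G\oplus\mathcal G$ is surjective. Its Weyl function is $M(z)=\Gamma_1(\Gamma_0\upharpoonright\ker(S^*-z))^{-1}$, $z\in\rho(S^*\upharpoonright\ker\Gamma_0)$, a bounded operator in $\mathcal G$. Notation for direct sums: $\mathfrak H=\bigoplus_n\mathfrak H_n$ and $\mathcal H=\bigoplus_n\mathcal H_n$ are Hilbert direct sums. $\mathfrak H_{n+}=\operatorname{dom}(S_n^* )$ and $\mathfrak H_+=\operatorname{dom}(A^* )$ carry the graph norms $\|f_n\|^2_{\mathfrak H_{n+}}=\|f_n\|^2+\|S_n^*f_n\|^2$ and $\|f\|_{\mathfrak H_+}^2=\|f\|^2+\|A^*f\|^2$; $\|\Gamma_j^{(n)}\|$ is the norm of $\Gamma_j^{(n)}$ as a bounded operator from $\mathfrak H_{n+}$ to $\mathcal H_n$. The direct sum $\Pi=\bigoplus_n\Pi_n=\{\mathcal H,\Gamma_0,\Gamma_1\}$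 is defined by $\Gamma_j=\bigoplus_n\Gamma_j^{(n)}$, $\operatorname{dom}(\Gamma_j)=\{f=\bigoplus_nf_n\in\operatorname{dom}(A^* ):\sum_n\|\Gamma_j^{(n)}f_n\|^2_{\mathcal H_n}<\infty\}$. Further, $S_{nj}:=S_n^*\upharpoonright\ker\Gamma_j^{(n)}$, $\widetilde A_j:=\bigoplus_nS_{nj}$, $A_*:=A^*\upharpoonright\operatorname{dom}(\Gamma)$, and $A_{*j}:=A_*\upharpoonright\ker(\Gamma_j)$ (that is, $A^*$ restricted to $\{f\in\operatorname{dom}(\Gamma):\Gamma_jf=0\}$). Two closed extensions $A\subseteq\widetilde A_0,\widetilde A_1\subseteq A^*$ are transversal if $\operatorname{dom}(\widetilde A_0)\cap\operatorname{dom}(\widetilde A_1)=\operatorname{dom}(A)$ and $\operatorname{dom}(\widetilde A_0)+\operatorname{dom}(\widetilde A_1)=\operatorname{dom}(A^* )$. Boundary relation: a linear relation (multivalued linear mapping) $\Gamma$ from $\mathfrak H$ to $\mathcal H^2$ is a boundary relation for $A^*$ if (a) $\operatorname{dom}(\Gamma)$ is a dense subset of $\operatorname{dom}(A^* )$ (graph norm) and, with $A_*=A^*\upharpoonright\operatorname{dom}(\Gamma)$, $(A_*f,g)_{\mathfrak H}-(f,A_*g)_{\mathfrak H}=(l',h)_{\mathcal H}-(l,h')_{\mathcal H}$ for all $\{f,\{l,l'\}\},\{g,\{h,h'\}\}\in\Gamma$; and (b) $\Gamma$ is maximal: if $g,g'\in\mathfrak H$ and $h,h'\in\mathcal H$ satisfy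 $(A_*f,g)-(f,g')=(l',h)-(l,h')$ for every $\{f,\{l,l'\}\}\in\Gamma$, then $\{g,\{h,h'\}\}\in\Gamma$. For single-valued $\Gamma=\{\Gamma_0,\Gamma_1\}$ the corresponding Weyl function at $z\in\mathbb C\setminus\mathbb R$ is the linear relation $M(z)=\{\{\Gamma_0f,\Gamma_1f\}:f\in\operatorname{dom}(\Gamma),\ A_*f=zf\}$. The direct sum $\bigoplus_nM_n(z)$ is the (possibly unbounded) operator on $\mathcal H$ with maximal domain $\{\bigoplus h_n\in\mathcal H:\sum\|M_n(z)h_n\|^2<\infty\}$. *)

theory Defs
  imports "HOL-Analysis.Analysis" "HOL-Library.Function_Algebras"
begin

section \<open>Complex vector spaces\<close>

class complex_vector = ab_group_add +
  fixes scaleC :: "complex \<Rightarrow> 'a \<Rightarrow> 'a"  (infixr "*\<^sub>C" 75)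
  assumes scaleC_add_right: "a *\<^sub>C (x + y) = a *\<^sub>C x + a *\<^sub>C y"
    and scaleC_add_left: "(a + b) *\<^sub>C x = a *\<^sub>C x + b *\<^sub>C x"
    and scaleC_scaleC: "a *\<^sub>C b *\<^sub>C x = (a * b) *\<^sub>C x"
    and scaleC_one: "1 *\<^sub>C x = x"

global_interpretation complex_vector:
  vector_space "scaleC :: complex \<Rightarrow> 'a \<Rightarrow> 'a::complex_vector"
  by unfold_locales (simp_all add: scaleC_add_right scaleC_add_left scaleC_scaleC scaleC_one)

instantiation "fun" :: (type, complex_vector) complex_vector
begin

definition scaleC_fun_def: "c *\<^sub>C f = (\<lambda>x. c *\<^sub>C f x)"

instance
  by standard
    (simp_all add: scaleC_fun_def fun_eq_iff scaleC_add_right scaleC_add_left scaleC_scaleC scaleC_one)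

end

instantiation prod :: (complex_vector, complex_vector) complex_vector
begin

definition scaleC_prod_def: "c *\<^sub>C p = (c *\<^sub>C fst p, c *\<^sub>C snd p)"

instance
  by standard
    (simp_all add: scaleC_prod_def prod_eq_iff scaleC_add_right scaleC_add_left scaleC_scaleC scaleC_one)

end


section \<open>Hilbert spaces\<close>

text \<open>
  A Hilbert space is given by a linear subspace of some complex vector space together with an
  inner product on that subspace.  In this way the members of a sequence of Hilbert spaces can be
  different spaces, each with its own inner product, and Hilbert direct sums, orthogonal sums of
  two spaces and domains with graph norms are again objects of the same kind.  Nothing is assumed
  about the values of the inner product outside the carrier.
\<close>

record 'a hspace =
  carr :: "'a set"
  ip :: "'a \<Rightarrow> 'a \<Rightarrow> complex"

definition nrm :: "'a hspace \<Rightarrow> 'a \<Rightarrow> real" where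
  "nrm H x = sqrt (Re (ip H x x))"

definition hilbert_space :: "'a::complex_vector hspace \<Rightarrow> bool" where
  "hilbert_space H \<longleftrightarrow>
     complex_vector.subspace (carr H) \<and>
     (\<forall>x\<in>carr H. \<forall>y\<in>carr H. \<forall>z\<in>carr H. ip H (x + y) z = ip H x z + ip H y z) \<and>
     (\<forall>c. \<forall>x\<in>carr H. \<forall>y\<in>carr H. ip H (c *\<^sub>C x) y = c * ip H x y) \<and>
     (\<forall>x\<in>carr H. \<forall>y\<in>carr H. ip H x y = cnj (ip H y x)) \<and>
     (\<forall>x\<in>carr H. x \<noteq> 0 \<longrightarrow> Re (ip H x x) > 0) \<and>
     (\<forall>X. (\<forall>k. X k \<in> carr H) \<and>
          (\<forall>e>0. \<exists>N. \<forall>k\<ge>N. \<forall>l\<ge>N. nrm H (X k - X l) < e) \<longrightarrow>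
          (\<exists>x\<in>carr H. (\<lambda>k. nrm H (X k - x)) \<longlonglongrightarrow> 0))"

definition hclosure :: "'a::complex_vector hspace \<Rightarrow> 'a set \<Rightarrow> 'a set" where
  "hclosure H D = {x \<in> carr H. \<forall>e>0. \<exists>y\<in>D. nrm H (x - y) < e}"

definition hclosed :: "'a::complex_vector hspace \<Rightarrow> 'a set \<Rightarrow> bool" where
  "hclosed H D \<longleftrightarrow> hclosure H D = D"

definition hdense :: "'a::complex_vector hspace \<Rightarrow> 'a set \<Rightarrow> bool" where
  "hdense H D \<longleftrightarrow> D \<subseteq> carr H \<and> hclosure H D = carr H"

definition hprod :: "'a hspace \<Rightarrow> 'b hspace \<Rightarrow> ('a \<times> 'b) hspace"  (infixr "\<oplus>\<^sub>H" 65) where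
  "H \<oplus>\<^sub>H K = \<lparr>carr = carr H \<times> carr K,
               ip = (\<lambda>(x, y) (x', y'). ip H x x' + ip K y y')\<rparr>"

definition hsum :: "(nat \<Rightarrow> 'a hspace) \<Rightarrow> (nat \<Rightarrow> 'a) hspace" where
  "hsum H = \<lparr>carr = {f. (\<forall>n. f n \<in> carr (H n)) \<and> summable (\<lambda>n. (nrm (H n) (f n))\<^sup>2)},
             ip = (\<lambda>f g. \<Sum>n. ip (H n) (f n) (g n))\<rparr>"

definition orthonormal_basis :: "'a::complex_vector hspace \<Rightarrow> 'a set \<Rightarrow> 'a set \<Rightarrow> bool" where
  "orthonormal_basis H N B \<longleftrightarrow>
     B \<subseteq> N \<and> (\<forall>x\<in>B. \<forall>y\<in>B. ip H x y = (if x = y then 1 else 0)) \<and>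
     hclosure H (complex_vector.span B) = N"

text \<open>Equality of the Hilbert dimensions (arbitrary cardinals) of two closed subspaces.\<close>

definition same_hilbert_dim :: "'a::complex_vector hspace \<Rightarrow> 'a set \<Rightarrow> 'a set \<Rightarrow> bool" where
  "same_hilbert_dim H N N' \<longleftrightarrow>
     (\<exists>B B'. orthonormal_basis H N B \<and> orthonormal_basis H N' B' \<and> B \<approx> B')"


section \<open>Linear relations and operators\<close>

text \<open>
  Linear relations are sets of pairs, and operators are identified with their graphs.
\<close>

definition linear_relation ::
  "'a::complex_vector hspace \<Rightarrow> 'b::complex_vector hspace \<Rightarrow> ('a \<times> 'b) set \<Rightarrow> bool" where
  "linear_relation H K T \<longleftrightarrow> T \<subseteq> carr H \<times> carr K \<and> complex_vector.subspace T"

definition linear_operator ::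
  "'a::complex_vector hspace \<Rightarrow> 'b::complex_vector hspace \<Rightarrow> ('a \<times> 'b) set \<Rightarrow> bool" where
  "linear_operator H K T \<longleftrightarrow> linear_relation H K T \<and> single_valued T"

definition app :: "('a \<times> 'b) set \<Rightarrow> 'a \<Rightarrow> 'b" where
  "app T x = (THE y. (x, y) \<in> T)"

definition ker :: "('a \<times> 'b::zero) set \<Rightarrow> 'a set" where
  "ker T = {x. (x, 0) \<in> T}"

definition restr :: "('a \<times> 'b) set \<Rightarrow> 'a set \<Rightarrow> ('a \<times> 'b) set"  (infixl "\<restriction>" 70) where
  "T \<restriction> D = {(x, y) \<in> T. x \<in> D}"

definition closed_relation ::
  "'a::complex_vector hspace \<Rightarrow> 'b::complex_vector hspace \<Rightarrow> ('a \<times> 'b) set \<Rightarrow> bool" where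
  "closed_relation H K T \<longleftrightarrow> hclosed (H \<oplus>\<^sub>H K) T"

definition rel_closure ::
  "'a::complex_vector hspace \<Rightarrow> 'b::complex_vector hspace \<Rightarrow> ('a \<times> 'b) set \<Rightarrow> ('a \<times> 'b) set" where
  "rel_closure H K T = hclosure (H \<oplus>\<^sub>H K) T"

definition closable ::
  "'a::complex_vector hspace \<Rightarrow> 'b::complex_vector hspace \<Rightarrow> ('a \<times> 'b) set \<Rightarrow> bool" where
  "closable H K T \<longleftrightarrow> linear_operator H K T \<and> linear_operator H K (rel_closure H K T)"

text \<open>
  Boundedness on the domain of the operator, which need not be the whole space.
\<close>

definition bounded_operator ::
  "'a::complex_vector hspace \<Rightarrow> 'b::complex_vector hspace \<Rightarrow> ('a \<times> 'b) set \<Rightarrow> bool" where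
  "bounded_operator H K T \<longleftrightarrow>
     linear_operator H K T \<and> (\<exists>C. \<forall>(x, y)\<in>T. nrm K y \<le> C * nrm H x)"

definition op_norm :: "'a hspace \<Rightarrow> 'b hspace \<Rightarrow> ('a \<times> 'b) set \<Rightarrow> ereal" where
  "op_norm H K T = (SUP (x, y) \<in> {(x, y) \<in> T. nrm H x \<le> 1}. ereal (nrm K y))"

definition adj :: "'a hspace \<Rightarrow> ('a \<times> 'a) set \<Rightarrow> ('a \<times> 'a) set" where
  "adj H T = {(g, g'). g \<in> carr H \<and> g' \<in> carr H \<and> (\<forall>(f, f')\<in>T. ip H f' g = ip H f g')}"

definition self_adjoint :: "'a::complex_vector hspace \<Rightarrow> ('a \<times> 'a) set \<Rightarrow> bool" where
  "self_adjoint H T \<longleftrightarrow> linear_operator H H T \<and> hdense H (Domain T) \<and> T = adj H T"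

definition essentially_self_adjoint :: "'a::complex_vector hspace \<Rightarrow> ('a \<times> 'a) set \<Rightarrow> bool" where
  "essentially_self_adjoint H T \<longleftrightarrow>
     linear_operator H H T \<and> hdense H (Domain T) \<and> self_adjoint H (rel_closure H H T)"

definition closed_symmetric :: "'a::complex_vector hspace \<Rightarrow> ('a \<times> 'a) set \<Rightarrow> bool" where
  "closed_symmetric H T \<longleftrightarrow>
     linear_operator H H T \<and> hdense H (Domain T) \<and> closed_relation H H T \<and> T \<subseteq> adj H T"

definition eigenspace :: "('a \<times> 'a::complex_vector) set \<Rightarrow> complex \<Rightarrow> 'a set" where
  "eigenspace T z = {f. (f, z *\<^sub>C f) \<in> T}"

definition equal_deficiency_indices :: "'a::complex_vector hspace \<Rightarrow> ('a \<times> 'a) set \<Rightarrow> bool" where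
  "equal_deficiency_indices H S \<longleftrightarrow>
     same_hilbert_dim H (eigenspace (adj H S) \<i>) (eigenspace (adj H S) (-\<i>))"

text \<open>The domain of an operator with the graph inner product.\<close>

definition graph_space :: "'a hspace \<Rightarrow> ('a \<times> 'a) set \<Rightarrow> 'a hspace" where
  "graph_space H T = \<lparr>carr = Domain T,
                      ip = (\<lambda>f g. ip H f g + ip H (app T f) (app T g))\<rparr>"

text \<open>
  The direct sum with maximal domain: for operators, its domain consists of those \<open>f\<close> in the
  Hilbert sum with every component in the domain and with square summable images.
\<close>

definition op_sum ::
  "(nat \<Rightarrow> 'a hspace) \<Rightarrow> (nat \<Rightarrow> 'b hspace) \<Rightarrow> (nat \<Rightarrow> ('a \<times> 'b) set) \<Rightarrow> ((nat \<Rightarrow> 'a) \<times> (nat \<Rightarrow> 'b)) set"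
  where
  "op_sum H K T = {(f, g). f \<in> carr (hsum H) \<and> g \<in> carr (hsum K) \<and> (\<forall>n. (f n, g n) \<in> T n)}"

text \<open>To be used for closed extensions \<open>T0\<close>, \<open>T1\<close> of \<open>A\<close> that are contained in \<open>adj H A\<close>.\<close>

definition transversal ::
  "'a::complex_vector hspace \<Rightarrow> ('a \<times> 'a) set \<Rightarrow> ('a \<times> 'a) set \<Rightarrow> ('a \<times> 'a) set \<Rightarrow> bool" where
  "transversal H A T0 T1 \<longleftrightarrow>
     Domain T0 \<inter> Domain T1 = Domain A \<and>
     {f + g |f g. f \<in> Domain T0 \<and> g \<in> Domain T1} = Domain (adj H A)"


section \<open>Boundary triplets and boundary relations\<close>

definition boundary_triplet ::
  "'a::complex_vector hspace \<Rightarrow> ('a \<times> 'a) set \<Rightarrow> 'b::complex_vector hspace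
    \<Rightarrow> ('a \<times> 'b) set \<Rightarrow> ('a \<times> 'b) set \<Rightarrow> bool" where
  "boundary_triplet H S G \<Gamma>0 \<Gamma>1 \<longleftrightarrow>
     hilbert_space G \<and>
     Domain \<Gamma>0 = Domain (adj H S) \<and> bounded_operator (graph_space H (adj H S)) G \<Gamma>0 \<and>
     Domain \<Gamma>1 = Domain (adj H S) \<and> bounded_operator (graph_space H (adj H S)) G \<Gamma>1 \<and>
     (\<forall>f\<in>Domain (adj H S). \<forall>g\<in>Domain (adj H S).
        ip H (app (adj H S) f) g - ip H f (app (adj H S) g) =
        ip G (app \<Gamma>1 f) (app \<Gamma>0 g) - ip G (app \<Gamma>0 f) (app \<Gamma>1 g)) \<and>
     (\<forall>h\<in>carr G. \<forall>h'\<in>carr G. \<exists>f. (f, h) \<in> \<Gamma>0 \<and> (f, h') \<in> \<Gamma>1)"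

text \<open>
  \<open>\<Gamma>\<^sub>1 (\<Gamma>\<^sub>0 \<restriction> ker (S\<^sup>* - z))\<^sup>-\<^sup>1\<close>; note that \<open>R O T\<close> applies \<open>R\<close> first.
\<close>

definition triplet_weyl ::
  "'a::complex_vector hspace \<Rightarrow> ('a \<times> 'a) set \<Rightarrow> ('a \<times> 'b) set \<Rightarrow> ('a \<times> 'b) set
    \<Rightarrow> complex \<Rightarrow> ('b \<times> 'b) set" where
  "triplet_weyl H S \<Gamma>0 \<Gamma>1 z = (\<Gamma>0 \<restriction> eigenspace (adj H S) z)\<inverse> O \<Gamma>1"

text \<open>
  Here \<open>T\<close> plays the role of \<open>A\<^sup>*\<close>, so that \<open>A\<^sub>*\<close> is \<open>T \<restriction> Domain \<Gamma>\<close>.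
\<close>

definition boundary_relation ::
  "'a::complex_vector hspace \<Rightarrow> ('a \<times> 'a) set \<Rightarrow> 'b::complex_vector hspace
    \<Rightarrow> ('a \<times> 'b \<times> 'b) set \<Rightarrow> bool" where
  "boundary_relation H T K \<Gamma> \<longleftrightarrow>
     linear_relation H (K \<oplus>\<^sub>H K) \<Gamma> \<and>
     Domain \<Gamma> \<subseteq> Domain T \<and> hdense (graph_space H T) (Domain \<Gamma>) \<and>
     (\<forall>(f, l, l')\<in>\<Gamma>. \<forall>(g, h, h')\<in>\<Gamma>.
        ip H (app (T \<restriction> Domain \<Gamma>) f) g - ip H f (app (T \<restriction> Domain \<Gamma>) g) = ip K l' h - ip K l h') \<and>
     (\<forall>g\<in>carr H. \<forall>g'\<in>carr H. \<forall>h\<in>carr K. \<forall>h'\<in>carr K.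
        (\<forall>(f, l, l')\<in>\<Gamma>. ip H (app (T \<restriction> Domain \<Gamma>) f) g - ip H f g' = ip K l' h - ip K l h')
        \<longrightarrow> (g, h, h') \<in> \<Gamma>)"

definition relation_weyl ::
  "('a \<times> 'a::complex_vector) set \<Rightarrow> ('a \<times> 'b \<times> 'b) set \<Rightarrow> complex \<Rightarrow> ('b \<times> 'b) set" where
  "relation_weyl T \<Gamma> z = {(h, h'). \<exists>f. (f, h, h') \<in> \<Gamma> \<and> (f, z *\<^sub>C f) \<in> T \<restriction> Domain \<Gamma>}"

end

theory Submission
  imports Defs
begin

text \<open>
  Everything except unbounded sums can be checked componentwise.  Evaluating the abstract Green
  identity of a single triplet on \<open>S\<^sub>n\<close> shows that both boundary maps vanish there, so that Green's
  identity and surjectivity of \<open>(\<Gamma>\<^sub>0, \<Gamma>\<^sub>1)\<close> already characterize the elements of the triplet; testing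
  with sequences supported at one index gives the maximality of the direct sum, and truncation gives
  the density and closure statements.  Each \<open>\<Gamma>\<^sub>j\<close> is a direct sum of bounded operators from the graph
  spaces, hence already closed, so that \<open>\<Gamma>\<^sub>j\<close> coincides with its closure.
  Under transversality \<open>dom \<Gamma>\<^sub>j\<^sub>'\<close> contains \<open>dom A\<^sub>j\<^sub>'\<close> trivially and \<open>dom A\<^sub>j\<close> once \<open>A\<^sub>*\<^sub>j\<close> is self-adjoint,
  hence all of \<open>dom A\<^sup>*\<close>.  Completeness of the spaces plays no role.
\<close>

section \<open>Inner product spaces\<close>

text \<open>The obstacle is that an element of \<open>As\<close> may have boundary values that are
  not square summable, so the sum of the triplets need be neither defined on all of dom A^* nor
  onto. What keeps closedness accessible is that the graph space of \<open>As\<close> is isometric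
  to the Hilbert sum of the component graph spaces: relative to it each boundary map is a sum, with
  maximal domain, of everywhere defined bounded maps, and C_j is the supremum of their norms.
  Finiteness of C_j from a full domain comes from a gliding hump instead of the closed graph
  theorem. The crossing of the indices j and j' has a simple origin: on the kernel of one boundary
  map its own summability condition is void, so A_*j is the self-adjoint sum of the S_nj cut down to
  the domain of the other boundary map. For the Weyl function, square summability of the defect
  elements has to be recovered from that of their boundary values; Green's identity gives it, since
  its left side is 2i Im z times the squared norm.\<close>

locale pre_hilbert =
  fixes H :: "'a::complex_vector hspace"
  assumes subspace_carr: "complex_vector.subspace (carr H)"
    and ip_add_left: "\<lbrakk>x \<in> carr H; y \<in> carr H; z \<in> carr H\<rbrakk> \<Longrightarrow> ip H (x + y) z = ip H x z + ip H y z"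
    and ip_scale_left: "\<lbrakk>x \<in> carr H; y \<in> carr H\<rbrakk> \<Longrightarrow> ip H (c *\<^sub>C x) y = c * ip H x y"
    and ip_cnj: "\<lbrakk>x \<in> carr H; y \<in> carr H\<rbrakk> \<Longrightarrow> ip H x y = cnj (ip H y x)"
    and ip_pos: "\<lbrakk>x \<in> carr H; x \<noteq> 0\<rbrakk> \<Longrightarrow> Re (ip H x x) > 0"

lemma hilbert_space_imp_pre_hilbert: "hilbert_space H \<Longrightarrow> pre_hilbert H"
  unfolding hilbert_space_def by unfold_locales blast+

context pre_hilbert
begin

lemma zero_mem [simp]: "0 \<in> carr H"
  by (rule complex_vector.subspace_0[OF subspace_carr])

lemma add_mem [simp]: "x \<in> carr H \<Longrightarrow> y \<in> carr H \<Longrightarrow> x + y \<in> carr H"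
  by (rule complex_vector.subspace_add[OF subspace_carr])

lemma diff_mem [simp]: "x \<in> carr H \<Longrightarrow> y \<in> carr H \<Longrightarrow> x - y \<in> carr H"
  by (rule complex_vector.subspace_diff[OF subspace_carr])

lemma scale_mem [simp]: "x \<in> carr H \<Longrightarrow> c *\<^sub>C x \<in> carr H"
  by (rule complex_vector.subspace_scale[OF subspace_carr])

lemma ip_zero_left [simp]: "y \<in> carr H \<Longrightarrow> ip H 0 y = 0"
  using ip_add_left[of 0 0 y] by simp

lemma ip_zero_right [simp]: "y \<in> carr H \<Longrightarrow> ip H y 0 = 0"
  using ip_cnj[of y 0] by simp

lemma ip_diff_left: "\<lbrakk>x \<in> carr H; y \<in> carr H; z \<in> carr H\<rbrakk> \<Longrightarrow> ip H (x - y) z = ip H x z - ip H y z"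
  using ip_add_left[of "x - y" y z] by simp

lemma ip_add_right: "\<lbrakk>x \<in> carr H; y \<in> carr H; z \<in> carr H\<rbrakk> \<Longrightarrow> ip H z (x + y) = ip H z x + ip H z y"
  using ip_cnj[of z "x + y"] ip_cnj[of z x] ip_cnj[of z y] by (simp add: ip_add_left)

lemma ip_diff_right: "\<lbrakk>x \<in> carr H; y \<in> carr H; z \<in> carr H\<rbrakk> \<Longrightarrow> ip H z (x - y) = ip H z x - ip H z y"
  using ip_cnj[of z "x - y"] ip_cnj[of z x] ip_cnj[of z y] by (simp add: ip_diff_left)

lemma ip_scale_right: "\<lbrakk>x \<in> carr H; y \<in> carr H\<rbrakk> \<Longrightarrow> ip H x (c *\<^sub>C y) = cnj c * ip H x y"
  using ip_cnj[of x "c *\<^sub>C y"] ip_cnj[of x y] by (simp add: ip_scale_left)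

lemma Re_ip_nonneg: "x \<in> carr H \<Longrightarrow> 0 \<le> Re (ip H x x)"
  using ip_pos[of x] by (cases "x = 0") auto

lemma nrm_power2: "x \<in> carr H \<Longrightarrow> (nrm H x)\<^sup>2 = Re (ip H x x)"
  by (simp add: nrm_def Re_ip_nonneg)

lemma ip_self: "x \<in> carr H \<Longrightarrow> ip H x x = of_real ((nrm H x)\<^sup>2)"
  using ip_cnj[of x x] by (simp add: nrm_power2 complex_eq_iff)

lemma nrm_nonneg [simp]: "x \<in> carr H \<Longrightarrow> 0 \<le> nrm H x"
  by (simp add: nrm_def Re_ip_nonneg)

lemma nrm_zero [simp]: "nrm H 0 = 0"
  by (simp add: nrm_def)

lemma nrm_eq_0: "x \<in> carr H \<Longrightarrow> nrm H x = 0 \<longleftrightarrow> x = 0"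
  using ip_pos[of x] nrm_power2[of x] by (cases "x = 0") auto

lemma nrm_scale: "x \<in> carr H \<Longrightarrow> nrm H (c *\<^sub>C x) = cmod c * nrm H x"
proof -
  assume x: "x \<in> carr H"
  have "ip H (c *\<^sub>C x) (c *\<^sub>C x) = (c * cnj c) * ip H x x"
    using x by (simp add: ip_scale_left ip_scale_right)
  also have "\<dots> = of_real ((cmod c)\<^sup>2 * (nrm H x)\<^sup>2)"
    using x by (simp add: ip_self flip: complex_norm_square)
  finally have "(nrm H (c *\<^sub>C x))\<^sup>2 = (cmod c * nrm H x)\<^sup>2"
    using x by (simp add: nrm_power2 power_mult_distrib)
  then show ?thesis using x by (simp add: power2_eq_iff_nonneg)
qed

lemma nrm_diff_commute: "\<lbrakk>x \<in> carr H; y \<in> carr H\<rbrakk> \<Longrightarrow> nrm H (x - y) = nrm H (y - x)"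
  using ip_diff_left[of x y "x - y"] ip_diff_left[of y x "y - x"]
  by (simp add: nrm_def ip_diff_right)

lemma Cauchy_Schwarz:
  assumes x: "x \<in> carr H" and y: "y \<in> carr H"
  shows "cmod (ip H x y) \<le> nrm H x * nrm H y"
proof (cases "y = 0")
  case False
  let ?n = "(nrm H y)\<^sup>2"
  have n: "?n > 0" using False y ip_pos[of y] nrm_power2[of y] by simp
  \<comment> \<open>The coefficient of the orthogonal projection of \<open>x\<close> onto
    \<open>y\<close>; the inequality says that the squared distance from \<open>x\<close> to this
    projection is nonnegative.\<close>
  define a where "a = ip H x y / of_real ?n"
  have 1: "ip H y x = cnj (ip H x y)" using x y ip_cnj by blast
  have "ip H (x - a *\<^sub>C y) (x - a *\<^sub>C y)
      = ip H x x - cnj a * ip H x y - a * ip H y x + a * cnj a * ip H y y"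
    using x y by (simp add: ip_diff_left ip_diff_right ip_scale_left ip_scale_right algebra_simps)
  also have "\<dots> = of_real ((nrm H x)\<^sup>2 - (cmod (ip H x y))\<^sup>2 / ?n)"
    using n x y unfolding a_def 1
    by (simp add: ip_self complex_norm_square field_simps del: of_real_power of_real_mult) (simp add: power2_eq_square)
  finally have "0 \<le> (nrm H x)\<^sup>2 - (cmod (ip H x y))\<^sup>2 / ?n"
    using Re_ip_nonneg[of "x - a *\<^sub>C y"] x y by simp
  then have "(cmod (ip H x y))\<^sup>2 \<le> (nrm H x * nrm H y)\<^sup>2"
    using n by (simp add: field_simps power_mult_distrib)
  then show ?thesis by (rule power2_le_imp_le) (use x y in simp)
qed (use x in simp)

lemma nrm_add_le:
  assumes x: "x \<in> carr H" and y: "y \<in> carr H"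
  shows "nrm H (x + y) \<le> nrm H x + nrm H y"
proof -
  have "(nrm H (x + y))\<^sup>2 = (nrm H x)\<^sup>2 + (nrm H y)\<^sup>2 + Re (ip H x y) + Re (ip H y x)"
    using x y by (simp add: nrm_power2 ip_add_left ip_add_right)
  also have "\<dots> \<le> (nrm H x)\<^sup>2 + (nrm H y)\<^sup>2 + nrm H x * nrm H y + nrm H y * nrm H x"
    using Cauchy_Schwarz[OF x y] Cauchy_Schwarz[OF y x]
      complex_Re_le_cmod[of "ip H x y"] complex_Re_le_cmod[of "ip H y x"] by linarith
  also have "\<dots> = (nrm H x + nrm H y)\<^sup>2" by (simp add: power2_eq_square algebra_simps)
  finally show ?thesis by (rule power2_le_imp_le) (use x y in simp)
qed

lemma nrm_diff_triangle:
  "\<lbrakk>x \<in> carr H; y \<in> carr H; z \<in> carr H\<rbrakk> \<Longrightarrow> nrm H (x - z) \<le> nrm H (x - y) + nrm H (y - z)"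
  using nrm_add_le[of "x - y" "y - z"] by simp

lemma nrm_add_power2_le:
  assumes x: "x \<in> carr H" and y: "y \<in> carr H"
  shows "(nrm H (x + y))\<^sup>2 \<le> 2 * (nrm H x)\<^sup>2 + 2 * (nrm H y)\<^sup>2"
proof -
  have "(nrm H (x + y))\<^sup>2 \<le> (nrm H x + nrm H y)\<^sup>2"
    using nrm_add_le[OF x y] x y by (intro power_mono) auto
  also have "\<dots> \<le> 2 * (nrm H x)\<^sup>2 + 2 * (nrm H y)\<^sup>2"
    using zero_le_power2[of "nrm H x - nrm H y"] by (simp add: power2_eq_square algebra_simps)
  finally show ?thesis .
qed

lemma ip_eqI:
  assumes "y \<in> carr H" "y' \<in> carr H" "\<And>x. x \<in> carr H \<Longrightarrow> ip H x y = ip H x y'"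
  shows "y = y'"
  using assms(3)[of "y - y'"] assms(1,2) ip_pos[of "y - y'"] by (auto simp: ip_diff_right)

section \<open>Closures and density\<close>

lemma hclosure_subset: "hclosure H D \<subseteq> carr H"
  by (auto simp: hclosure_def)

lemma subset_hclosure: "D \<subseteq> carr H \<Longrightarrow> D \<subseteq> hclosure H D"
  by (force simp: hclosure_def)

lemma hclosedI: "\<lbrakk>D \<subseteq> carr H; hclosure H D \<subseteq> D\<rbrakk> \<Longrightarrow> hclosed H D"
  unfolding hclosed_def using subset_hclosure by blast

lemma hclosureI_sequentially:
  assumes "x \<in> carr H" "\<And>k. X k \<in> D" "(\<lambda>k. nrm H (x - X k)) \<longlonglongrightarrow> 0"
  shows "x \<in> hclosure H D"
  unfolding hclosure_def
proof (intro CollectI conjI allI impI)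
  fix e :: real assume "e > 0"
  then obtain k where "norm (nrm H (x - X k) - 0) < e" using LIMSEQ_D[OF assms(3)] by blast
  then show "\<exists>y\<in>D. nrm H (x - y) < e" using assms(2)[of k] by (intro bexI[of _ "X k"]) auto
qed (fact assms(1))

text \<open>Approximating \<open>y\<close> itself from \<open>D\<close> avoids limits of inner
  products: \<open>ip H (y - x) y\<close> equals the squared norm of \<open>y\<close>, while
  Cauchy-Schwarz makes it smaller once \<open>x\<close> is closer to \<open>y\<close> than 0
  is.\<close>

lemma orthogonal_to_dense:
  assumes D: "hdense H D" and y: "y \<in> carr H" and 0: "\<And>x. x \<in> D \<Longrightarrow> ip H x y = 0"
  shows "y = 0"
proof (rule ccontr)
  assume "y \<noteq> 0"
  then have p: "nrm H y > 0" using nrm_eq_0[OF y] nrm_nonneg[OF y] by linarith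
  have "y \<in> hclosure H D" using D y by (simp add: hdense_def)
  then obtain x where x: "x \<in> D" "nrm H (y - x) < nrm H y" using p by (auto simp: hclosure_def)
  have xc: "x \<in> carr H" using D x by (auto simp: hdense_def)
  have "ip H (y - x) y = of_real ((nrm H y)\<^sup>2)" using y xc 0[OF x(1)] by (simp add: ip_diff_left ip_self)
  then have "(nrm H y)\<^sup>2 \<le> nrm H (y - x) * nrm H y"
    using Cauchy_Schwarz[of "y - x" y] y xc by (simp add: norm_power)
  also have "\<dots> < nrm H y * nrm H y" using x p by simp
  finally show False by (simp add: power2_eq_square)
qed

end

lemma hclosure_mono: "D \<subseteq> E \<Longrightarrow> hclosure H D \<subseteq> hclosure H E"
  by (force simp: hclosure_def)

text \<open>Two records can describe the same space and still differ in \<open>ip\<close> outside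
  the carrier. This transfers closures between the graph space of a direct sum and the direct sum of
  the graph spaces.\<close>

lemma hclosure_cong:
  assumes "pre_hilbert H" "carr H = carr H'" "\<And>x. x \<in> carr H \<Longrightarrow> nrm H x = nrm H' x" "D \<subseteq> carr H"
  shows "hclosure H D = hclosure H' D"
proof -
  interpret pre_hilbert H by fact
  have "nrm H (x - y) = nrm H' (x - y)" if "x \<in> carr H" "y \<in> D" for x y
    using assms(3)[of "x - y"] assms(4) that by auto
  then show ?thesis unfolding hclosure_def using assms(2) by auto
qed

subsection \<open>Products and graph spaces\<close>

lemma carr_hprod [simp]: "carr (H \<oplus>\<^sub>H K) = carr H \<times> carr K"
  by (simp add: hprod_def)

lemma ip_hprod [simp]: "ip (H \<oplus>\<^sub>H K) (x, y) (x', y') = ip H x x' + ip K y y'"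
  by (simp add: hprod_def)

lemma pre_hilbert_hprod:
  assumes "pre_hilbert H" "pre_hilbert K" shows "pre_hilbert (H \<oplus>\<^sub>H K)"
proof -
  interpret H: pre_hilbert H by fact
  interpret K: pre_hilbert K by fact
  show ?thesis
  proof
    show "complex_vector.subspace (carr (H \<oplus>\<^sub>H K))"
      by (auto simp: complex_vector.subspace_def scaleC_prod_def zero_prod_def)
    show "ip (H \<oplus>\<^sub>H K) x y = cnj (ip (H \<oplus>\<^sub>H K) y x)" if "x \<in> carr (H \<oplus>\<^sub>H K)" "y \<in> carr (H \<oplus>\<^sub>H K)" for x y
      using that H.ip_cnj[of "fst x" "fst y"] K.ip_cnj[of "snd x" "snd y"] by (cases x; cases y) simp
    show "0 < Re (ip (H \<oplus>\<^sub>H K) x x)" if "x \<in> carr (H \<oplus>\<^sub>H K)" "x \<noteq> 0" for x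
      using that H.ip_pos[of "fst x"] K.ip_pos[of "snd x"] H.Re_ip_nonneg[of "fst x"] K.Re_ip_nonneg[of "snd x"]
      by (cases x; cases "fst x = 0") (auto simp: zero_prod_def add_pos_nonneg add_nonneg_pos)
  qed (auto simp: H.ip_add_left K.ip_add_left H.ip_scale_left K.ip_scale_left scaleC_prod_def algebra_simps)
qed

lemma nrm_hprod:
  assumes "pre_hilbert H" "pre_hilbert K" "x \<in> carr H" "y \<in> carr K"
  shows "nrm (H \<oplus>\<^sub>H K) (x, y) = sqrt ((nrm H x)\<^sup>2 + (nrm K y)\<^sup>2)"
  using pre_hilbert.nrm_power2[OF assms(1,3)] pre_hilbert.nrm_power2[OF assms(2,4)]
  by (simp add: nrm_def[of "H \<oplus>\<^sub>H K"])

text \<open>The product norm lies between the larger of the two component norms and their sum, so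
  closeness may be tested in each component separately. All closure arguments for graphs below use
  this form.\<close>

lemma mem_hclosure_hprod:
  assumes "pre_hilbert H" "pre_hilbert K" and D: "D \<subseteq> carr H \<times> carr K"
  shows "(x, y) \<in> hclosure (H \<oplus>\<^sub>H K) D \<longleftrightarrow> x \<in> carr H \<and> y \<in> carr K \<and>
    (\<forall>e>0. \<exists>(a, b)\<in>D. nrm H (x - a) < e \<and> nrm K (y - b) < e)" (is "_ \<longleftrightarrow> ?R")
proof -
  interpret H: pre_hilbert H by fact
  interpret K: pre_hilbert K by fact
  have n: "nrm (H \<oplus>\<^sub>H K) ((x, y) - (a, b)) = sqrt ((nrm H (x - a))\<^sup>2 + (nrm K (y - b))\<^sup>2)"
    if "x \<in> carr H" "y \<in> carr K" "(a, b) \<in> D" for a b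
    using that D by (auto intro!: nrm_hprod H.pre_hilbert_axioms K.pre_hilbert_axioms)
  show ?thesis
  proof
    assume L: "(x, y) \<in> hclosure (H \<oplus>\<^sub>H K) D"
    then have xy: "x \<in> carr H" "y \<in> carr K" by (auto simp: hclosure_def)
    have "\<exists>(a, b)\<in>D. nrm H (x - a) < e \<and> nrm K (y - b) < e" if e: "e > 0" for e
    proof -
      obtain p where "p \<in> D" "nrm (H \<oplus>\<^sub>H K) ((x, y) - p) < e"
        using L e unfolding hclosure_def mem_Collect_eq by blast
      then obtain a b where ab: "(a, b) \<in> D" "nrm (H \<oplus>\<^sub>H K) ((x, y) - (a, b)) < e"
        by (cases p) blast
      have "nrm H (x - a) \<le> sqrt ((nrm H (x - a))\<^sup>2 + (nrm K (y - b))\<^sup>2)"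
        "nrm K (y - b) \<le> sqrt ((nrm H (x - a))\<^sup>2 + (nrm K (y - b))\<^sup>2)"
        by (rule real_le_rsqrt; simp)+
      then have "nrm H (x - a) < e" "nrm K (y - b) < e" using ab(2) n[OF xy ab(1)] by linarith+
      then show ?thesis by (intro bexI[OF _ ab(1)]) auto
    qed
    then show ?R using xy by blast
  next
    assume R: ?R
    have "\<exists>p\<in>D. nrm (H \<oplus>\<^sub>H K) ((x, y) - p) < e" if e: "e > 0" for e
    proof -
      obtain a b where ab: "(a, b) \<in> D" "nrm H (x - a) < e / 2" "nrm K (y - b) < e / 2"
        using R half_gt_zero[OF e] by blast
      have "sqrt ((nrm H (x - a))\<^sup>2 + (nrm K (y - b))\<^sup>2) \<le> nrm H (x - a) + nrm K (y - b)"
        using R ab(1) D by (intro sqrt_sum_squares_le_sum) auto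
      then show ?thesis using ab n R by (intro bexI[OF _ ab(1)]) auto
    qed
    then show "(x, y) \<in> hclosure (H \<oplus>\<^sub>H K) D" using R unfolding hclosure_def by simp
  qed
qed

lemma app_eq: "single_valued T \<Longrightarrow> (x, y) \<in> T \<Longrightarrow> app T x = y"
  unfolding app_def single_valued_def by blast

lemma subspace_prodD:
  assumes "complex_vector.subspace T"
  shows "(0, 0) \<in> T"
    and "(x, y) \<in> T \<Longrightarrow> (x', y') \<in> T \<Longrightarrow> (x + x', y + y') \<in> T"
    and "(x, y) \<in> T \<Longrightarrow> (x', y') \<in> T \<Longrightarrow> (x - x', y - y') \<in> T"
    and "(x, y) \<in> T \<Longrightarrow> (c *\<^sub>C x, c *\<^sub>C y) \<in> T"
  using complex_vector.subspace_0[OF assms] complex_vector.subspace_add[OF assms, of "(x,y)" "(x',y')"]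
    complex_vector.subspace_diff[OF assms, of "(x,y)" "(x',y')"]
    complex_vector.subspace_scale[OF assms, of "(x,y)" c]
  by (auto simp: zero_prod_def scaleC_prod_def)

lemma subspace_prodI:
  assumes "(0, 0) \<in> T"
    and "\<And>x y x' y'. (x, y) \<in> T \<Longrightarrow> (x', y') \<in> T \<Longrightarrow> (x + x', y + y') \<in> T"
    and "\<And>c x y. (x, y) \<in> T \<Longrightarrow> (c *\<^sub>C x, c *\<^sub>C y) \<in> T"
  shows "complex_vector.subspace T"
  using assms by (auto simp: complex_vector.subspace_def zero_prod_def scaleC_prod_def)

lemma linear_operatorD:
  assumes "linear_operator H K T"
  shows "T \<subseteq> carr H \<times> carr K" "complex_vector.subspace T" "single_valued T"
  using assms by (auto simp: linear_operator_def linear_relation_def)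

lemma carr_graph_space [simp]: "carr (graph_space H T) = Domain T"
  by (simp add: graph_space_def)

lemma pre_hilbert_graph_space:
  assumes "pre_hilbert H" and T: "linear_operator H H T"
  shows "pre_hilbert (graph_space H T)"
proof -
  interpret pre_hilbert H by fact
  note T = linear_operatorD[OF T]
  note lin = subspace_prodD[OF T(2)]
  have ip: "ip (graph_space H T) x y = ip H x y + ip H x' y'" if "(x, x') \<in> T" "(y, y') \<in> T" for x x' y y'
    using that T(3) by (simp add: graph_space_def app_eq)
  have Tc: "x \<in> carr H" "y \<in> carr H" if "(x, y) \<in> T" for x y using T(1) that by auto
  show ?thesis
  proof
    show "complex_vector.subspace (carr (graph_space H T))"
      unfolding complex_vector.subspace_def using lin by (auto simp: Domain_iff) blast+
    show "ip (graph_space H T) (x + y) z = ip (graph_space H T) x z + ip (graph_space H T) y z"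
      if "x \<in> carr (graph_space H T)" "y \<in> carr (graph_space H T)" "z \<in> carr (graph_space H T)" for x y z
      using that by (auto simp: ip[OF lin(2)] ip Tc ip_add_left)
    show "ip (graph_space H T) (c *\<^sub>C x) y = c * ip (graph_space H T) x y"
      if "x \<in> carr (graph_space H T)" "y \<in> carr (graph_space H T)" for c x y
      using that by (auto simp: ip[OF lin(4)] ip Tc ip_scale_left algebra_simps)
    show "ip (graph_space H T) x y = cnj (ip (graph_space H T) y x)"
      if "x \<in> carr (graph_space H T)" "y \<in> carr (graph_space H T)" for x y
    proof -
      from that obtain x' y' where 1: "(x, x') \<in> T" "(y, y') \<in> T" by auto
      show ?thesis using ip_cnj[of x y] ip_cnj[of x' y'] 1 by (simp add: ip Tc)
    qed
    show "0 < Re (ip (graph_space H T) x x)" if "x \<in> carr (graph_space H T)" "x \<noteq> 0" for x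
      using that by (auto simp: ip Tc add_pos_nonneg ip_pos Re_ip_nonneg)
  qed
qed

lemma nrm_graph_space:
  assumes "pre_hilbert H" "linear_operator H H T" "(x, y) \<in> T"
  shows "nrm (graph_space H T) x = sqrt ((nrm H x)\<^sup>2 + (nrm H y)\<^sup>2)"
proof -
  interpret pre_hilbert H by fact
  have "x \<in> carr H" "y \<in> carr H" "app T x = y"
    using assms(3) linear_operatorD[OF assms(2)] by (auto intro: app_eq)
  then show ?thesis unfolding nrm_def[of "graph_space H T"] by (simp add: graph_space_def nrm_power2)
qed

text \<open>The operator is defined at the limit point \<open>x\<close>, with some value
  \<open>v\<close>. For a graph point \<open>(a, b)\<close> close to \<open>(x, y)\<close>,
  boundedness at \<open>x - a\<close> makes \<open>b\<close> close to \<open>v\<close> as well as to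
  \<open>y\<close>.\<close>

lemma bounded_operator_closed:
  assumes "pre_hilbert H" "pre_hilbert K" and T: "bounded_operator H K T" and dom: "Domain T = carr H"
  shows "closed_relation H K T"
proof -
  interpret H: pre_hilbert H by fact
  interpret K: pre_hilbert K by fact
  interpret P: pre_hilbert "H \<oplus>\<^sub>H K" by (rule pre_hilbert_hprod) fact+
  from T have L: "linear_operator H K T" by (simp add: bounded_operator_def)
  note T' = linear_operatorD[OF L]
  obtain C where C: "\<And>x y. (x, y) \<in> T \<Longrightarrow> nrm K y \<le> C * nrm H x"
    using T by (auto simp: bounded_operator_def)
  show ?thesis unfolding closed_relation_def
  proof (rule P.hclosedI)
    show "hclosure (H \<oplus>\<^sub>H K) T \<subseteq> T"
    proof (clarify)
      fix x y assume xy: "(x, y) \<in> hclosure (H \<oplus>\<^sub>H K) T"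
      note xy = xy[unfolded mem_hclosure_hprod[OF assms(1,2) T'(1)]]
      obtain v where v: "(x, v) \<in> T" using dom xy by auto
      have vc: "v \<in> carr K" using v T' by auto
      have "nrm K (v - y) \<le> 0 + e" if "e > 0" for e
      proof -
        \<comment> \<open>The two errors contribute the factors \<open>\<bar>C\<bar>\<close> and 1,
          which together cancel the denominator. The absolute value is taken because the bound
          supplied by \<open>bounded_operator\<close> carries no sign.\<close>
        have "e / (\<bar>C\<bar> + 1) > 0" using that by (simp add: add_nonneg_pos)
        then obtain a b where ab: "(a, b) \<in> T" "nrm H (x - a) < e / (\<bar>C\<bar> + 1)" "nrm K (y - b) < e / (\<bar>C\<bar> + 1)"
          using xy by blast
        have c: "a \<in> carr H" "b \<in> carr K" using ab T' by auto
        have "nrm K (v - b) \<le> C * nrm H (x - a)" by (rule C[OF subspace_prodD(3)[OF T'(2) v ab(1)]])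
        also have "\<dots> \<le> \<bar>C\<bar> * (e / (\<bar>C\<bar> + 1))"
          using ab(2) c xy by (intro mult_mono) auto
        finally have "nrm K (v - y) \<le> \<bar>C\<bar> * (e / (\<bar>C\<bar> + 1)) + e / (\<bar>C\<bar> + 1)"
          using K.nrm_diff_triangle[of v b y] K.nrm_diff_commute[of b y] ab(3) c vc xy by simp
        also have "\<dots> = (\<bar>C\<bar> + 1) * (e / (\<bar>C\<bar> + 1))" by (simp only: distrib_right mult_1)
        also have "\<dots> = e" by simp
        finally show ?thesis by simp
      qed
      then have "nrm K (v - y) \<le> 0" by (rule field_le_epsilon)
      moreover have "0 \<le> nrm K (v - y)" "nrm K (v - y) = 0 \<longleftrightarrow> v - y = 0"
        using vc xy K.nrm_nonneg[of "v - y"] K.nrm_eq_0[of "v - y"] by simp_all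
      ultimately have "v = y" by simp
      then show "(x, y) \<in> T" using v by simp
    qed
  qed (use T' in simp)
qed

subsection \<open>Adjoints\<close>

context pre_hilbert
begin

lemma mem_adj: "(g, g') \<in> adj H T \<longleftrightarrow>
    g \<in> carr H \<and> g' \<in> carr H \<and> (\<forall>f f'. (f, f') \<in> T \<longrightarrow> ip H f' g = ip H f g')"
  by (auto simp: adj_def)

lemma linear_operator_adj:
  assumes T: "T \<subseteq> carr H \<times> carr H" and D: "hdense H (Domain T)"
  shows "linear_operator H H (adj H T)"
proof -
  have Tc: "x \<in> carr H" "y \<in> carr H" if "(x, y) \<in> T" for x y using T that by auto
  have "single_valued (adj H T)"
  proof (rule single_valuedI)
    fix g a b assume ab: "(g, a) \<in> adj H T" "(g, b) \<in> adj H T"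
    have "a - b = 0"
    proof (rule orthogonal_to_dense[OF D])
      fix f assume "f \<in> Domain T"
      then obtain f' where "(f, f') \<in> T" by auto
      then show "ip H f (a - b) = 0" using ab by (auto simp: mem_adj ip_diff_right Tc)
    qed (use ab in \<open>auto simp: mem_adj\<close>)
    then show "a = b" by simp
  qed
  moreover have "complex_vector.subspace (adj H T)"
    by (rule subspace_prodI) (auto simp: mem_adj Tc ip_add_right ip_scale_right)
  ultimately show ?thesis by (auto simp: linear_operator_def linear_relation_def mem_adj)
qed

lemma closed_relation_adj:
  assumes T: "T \<subseteq> carr H \<times> carr H"
  shows "closed_relation H H (adj H T)"
proof -
  interpret P: pre_hilbert "H \<oplus>\<^sub>H H" by (intro pre_hilbert_hprod pre_hilbert_axioms)
  have s: "adj H T \<subseteq> carr H \<times> carr H" by (auto simp: adj_def)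
  show ?thesis unfolding closed_relation_def
  proof (rule P.hclosedI)
    show "hclosure (H \<oplus>\<^sub>H H) (adj H T) \<subseteq> adj H T"
    proof clarify
      fix g g' assume "(g, g') \<in> hclosure (H \<oplus>\<^sub>H H) (adj H T)"
      note g = this[unfolded mem_hclosure_hprod[OF pre_hilbert_axioms pre_hilbert_axioms s]]
      have "ip H f' g = ip H f g'" if f: "(f, f') \<in> T" for f f'
      proof -
        have fc: "f \<in> carr H" "f' \<in> carr H" using f T by auto
        \<comment> \<open>The two perturbation terms of the inner products carry the factors
          \<open>nrm H f'\<close> and \<open>nrm H f\<close>; the summand 1 keeps the denominator
          positive when both vanish.\<close>
        let ?c = "nrm H f + nrm H f' + 1"
        have c: "?c > 0" using fc by (simp add: add_nonneg_pos)
        have "cmod (ip H f' g - ip H f g') \<le> 0 + e" if "e > 0" for e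
        proof -
          have "e / ?c > 0" using that c by simp
          then obtain y y' where y: "(y, y') \<in> adj H T" "nrm H (g - y) < e / ?c" "nrm H (g' - y') < e / ?c"
            using g by blast
          have yc: "y \<in> carr H" "y' \<in> carr H" "ip H f' y = ip H f y'" using y f by (auto simp: mem_adj)
          have "ip H f' g - ip H f g' = ip H f' (g - y) - ip H f (g' - y')"
            using yc fc g by (simp add: ip_diff_right)
          also have "cmod \<dots> \<le> nrm H f' * nrm H (g - y) + nrm H f * nrm H (g' - y')"
            using norm_triangle_ineq4 Cauchy_Schwarz yc fc g
            by (meson add_mono diff_mem order_trans)
          also have "\<dots> \<le> nrm H f' * (e / ?c) + nrm H f * (e / ?c)"
            using y fc by (intro add_mono mult_left_mono) auto
          also have "\<dots> = (nrm H f + nrm H f') * (e / ?c)" by (simp add: algebra_simps add_divide_distrib)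
          also have "\<dots> \<le> ?c * (e / ?c)" using that c by (intro mult_right_mono) auto
          finally show ?thesis using c by simp
        qed
        then have "cmod (ip H f' g - ip H f g') \<le> 0" by (rule field_le_epsilon)
        then show ?thesis by simp
      qed
      then show "(g, g') \<in> adj H T" using g by (auto simp: mem_adj)
    qed
  qed (use s in simp)
qed

end

section \<open>Hilbert sums\<close>

text \<open>Cutting off makes every summability condition trivial: any componentwise solution,
  however fast it grows, becomes a member of the direct sums with maximal domain.\<close>

definition trunc :: "nat \<Rightarrow> (nat \<Rightarrow> 'a) \<Rightarrow> nat \<Rightarrow> 'a::zero" where
  "trunc N f = (\<lambda>n. if n < N then f n else 0)"

text \<open>The embedding of one component into the sum. A global identity tested on such vectors
  becomes the identity in that component.\<close>

definition sing :: "nat \<Rightarrow> 'a \<Rightarrow> nat \<Rightarrow> 'a::zero" where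
  "sing n x = (\<lambda>m. if m = n then x else 0)"

lemma sing_same [simp]: "sing n x n = x"
  by (simp add: sing_def)

lemma mem_carr_hsum: "f \<in> carr (hsum H) \<longleftrightarrow> (\<forall>n. f n \<in> carr (H n)) \<and> summable (\<lambda>n. (nrm (H n) (f n))\<^sup>2)"
  by (simp add: hsum_def)

lemma ip_hsum: "ip (hsum H) f g = (\<Sum>n. ip (H n) (f n) (g n))"
  by (simp add: hsum_def)

lemma mem_op_sum: "(f, g) \<in> op_sum H K T \<longleftrightarrow>
    f \<in> carr (hsum H) \<and> g \<in> carr (hsum K) \<and> (\<forall>n. (f n, g n) \<in> T n)"
  by (simp add: op_sum_def)

locale pre_hilbert_seq =
  fixes H :: "nat \<Rightarrow> 'a::complex_vector hspace"
  assumes comp: "pre_hilbert (H n)"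
begin

sublocale c: pre_hilbert "H n" for n
  by (rule comp)

lemma summable_ip_norm:
  assumes f: "f \<in> carr (hsum H)" and g: "g \<in> carr (hsum H)"
  shows "summable (\<lambda>n. cmod (ip (H n) (f n) (g n)))"
proof (rule summable_comparison_test')
  show "summable (\<lambda>n. (nrm (H n) (f n))\<^sup>2 + (nrm (H n) (g n))\<^sup>2)"
    using f g by (intro summable_add) (auto simp: mem_carr_hsum)
  show "norm (cmod (ip (H n) (f n) (g n))) \<le> (nrm (H n) (f n))\<^sup>2 + (nrm (H n) (g n))\<^sup>2" for n
  proof -
    let ?a = "nrm (H n) (f n)" and ?b = "nrm (H n) (g n)"
    have c: "f n \<in> carr (H n)" "g n \<in> carr (H n)" using f g by (auto simp: mem_carr_hsum)
    have "cmod (ip (H n) (f n) (g n)) \<le> ?a * ?b" by (rule c.Cauchy_Schwarz[OF c])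
    also have "\<dots> \<le> ?a * ?b + (?a * ?b + (?a - ?b)\<^sup>2)"
      using c by simp
    also have "\<dots> = ?a\<^sup>2 + ?b\<^sup>2" by (simp add: power2_eq_square algebra_simps)
    finally show ?thesis by simp
  qed
qed

lemma summable_ip: "\<lbrakk>f \<in> carr (hsum H); g \<in> carr (hsum H)\<rbrakk> \<Longrightarrow> summable (\<lambda>n. ip (H n) (f n) (g n))"
  by (rule summable_norm_cancel[OF summable_ip_norm])

lemma ip_hsum_sums: "\<lbrakk>f \<in> carr (hsum H); g \<in> carr (hsum H)\<rbrakk> \<Longrightarrow>
    (\<lambda>n. ip (H n) (f n) (g n)) sums ip (hsum H) f g"
  unfolding ip_hsum by (rule summable_sums[OF summable_ip])

lemma subspace_carr_hsum: "complex_vector.subspace (carr (hsum H))"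
  unfolding complex_vector.subspace_def
proof (intro conjI ballI allI)
  show "0 \<in> carr (hsum H)" by (simp add: mem_carr_hsum)
next
  fix f g assume fg: "f \<in> carr (hsum H)" "g \<in> carr (hsum H)"
  have "summable (\<lambda>n. (nrm (H n) (f n + g n))\<^sup>2)"
  proof (rule summable_comparison_test')
    show "summable (\<lambda>n. 2 * (nrm (H n) (f n))\<^sup>2 + 2 * (nrm (H n) (g n))\<^sup>2)"
      using fg by (intro summable_add summable_mult) (auto simp: mem_carr_hsum)
    show "norm ((nrm (H n) (f n + g n))\<^sup>2) \<le> 2 * (nrm (H n) (f n))\<^sup>2 + 2 * (nrm (H n) (g n))\<^sup>2" for n
      using fg c.nrm_add_power2_le by (auto simp: mem_carr_hsum)
  qed
  then show "f + g \<in> carr (hsum H)" using fg by (auto simp: mem_carr_hsum)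
next
  fix a f assume f: "f \<in> carr (hsum H)"
  then have "summable (\<lambda>n. (cmod a)\<^sup>2 * (nrm (H n) (f n))\<^sup>2)"
    by (intro summable_mult) (auto simp: mem_carr_hsum)
  then show "a *\<^sub>C f \<in> carr (hsum H)"
    using f by (simp add: mem_carr_hsum scaleC_fun_def c.nrm_scale power_mult_distrib)
qed

sublocale s: pre_hilbert "hsum H"
proof
  show "complex_vector.subspace (carr (hsum H))" by (rule subspace_carr_hsum)
  show "ip (hsum H) (x + y) z = ip (hsum H) x z + ip (hsum H) y z"
    if "x \<in> carr (hsum H)" "y \<in> carr (hsum H)" "z \<in> carr (hsum H)" for x y z
    using sums_add[OF ip_hsum_sums[OF that(1,3)] ip_hsum_sums[OF that(2,3)]] that
    by (simp add: ip_hsum[of _ "x + y"] sums_iff c.ip_add_left mem_carr_hsum)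
  show "ip (hsum H) (a *\<^sub>C x) y = a * ip (hsum H) x y"
    if "x \<in> carr (hsum H)" "y \<in> carr (hsum H)" for a x y
    using sums_mult[OF ip_hsum_sums[OF that], of a] that
    by (simp add: ip_hsum[of _ "\<lambda>n. a *\<^sub>C x n"] sums_iff c.ip_scale_left mem_carr_hsum scaleC_fun_def)
  show "ip (hsum H) x y = cnj (ip (hsum H) y x)"
    if xy: "x \<in> carr (hsum H)" "y \<in> carr (hsum H)" for x y
  proof -
    have "(\<lambda>n. ip (H n) (x n) (y n)) = (\<lambda>n. cnj (ip (H n) (y n) (x n)))"
      using xy by (intro ext c.ip_cnj) (auto simp: mem_carr_hsum)
    then have "(\<lambda>n. ip (H n) (x n) (y n)) sums cnj (ip (hsum H) y x)"
      using ip_hsum_sums[OF xy(2,1)] by (simp add: sums_cnj)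
    then show ?thesis by (rule sums_unique2[OF ip_hsum_sums[OF xy]])
  qed
  show "0 < Re (ip (hsum H) x x)" if x: "x \<in> carr (hsum H)" "x \<noteq> 0" for x
  proof -
    have xc: "x n \<in> carr (H n)" for n using x by (auto simp: mem_carr_hsum)
    obtain n where n: "x n \<noteq> 0" using x(2) by (auto simp: fun_eq_iff)
    have "(\<lambda>n. Re (ip (H n) (x n) (x n))) sums Re (ip (hsum H) x x)"
      by (rule sums_Re[OF ip_hsum_sums[OF x(1) x(1)]])
    moreover have "0 < (\<Sum>n. Re (ip (H n) (x n) (x n)))"
      by (rule suminf_pos2[OF sums_summable[OF calculation], of n]) (use xc n c.Re_ip_nonneg c.ip_pos in auto)
    ultimately show ?thesis by (simp add: sums_iff)
  qed
qed

lemma nrm_hsum_sums: "f \<in> carr (hsum H) \<Longrightarrow> (\<lambda>n. (nrm (H n) (f n))\<^sup>2) sums (nrm (hsum H) f)\<^sup>2"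
proof -
  assume f: "f \<in> carr (hsum H)"
  then have "(\<lambda>n. (nrm (H n) (f n))\<^sup>2) = (\<lambda>n. Re (ip (H n) (f n) (f n)))"
    by (simp add: c.nrm_power2 mem_carr_hsum)
  then show ?thesis unfolding s.nrm_power2[OF f] using sums_Re[OF ip_hsum_sums[OF f f]] by simp
qed

lemma nrm_hsum: "f \<in> carr (hsum H) \<Longrightarrow> nrm (hsum H) f = sqrt (\<Sum>n. (nrm (H n) (f n))\<^sup>2)"
  using nrm_hsum_sums[of f] s.nrm_nonneg[of f] by (simp add: sums_iff)

lemma nrm_component_le: "f \<in> carr (hsum H) \<Longrightarrow> nrm (H n) (f n) \<le> nrm (hsum H) f"
proof -
  assume f: "f \<in> carr (hsum H)"
  have "(nrm (H n) (f n))\<^sup>2 \<le> (nrm (hsum H) f)\<^sup>2"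
    using sum_le_suminf[OF sums_summable[OF nrm_hsum_sums[OF f]], of "{n}"] nrm_hsum_sums[OF f]
    by (simp add: sums_iff)
  then show ?thesis by (rule power2_le_imp_le) (use f in simp)
qed

section \<open>Finitely supported sequences\<close>

lemma finite_support_mem_carr:
  assumes "\<And>n. f n \<in> carr (H n)" "\<And>n. n \<ge> N \<Longrightarrow> f n = 0"
  shows "f \<in> carr (hsum H)"
proof -
  have "summable (\<lambda>n. (nrm (H n) (f n))\<^sup>2)"
    by (rule summable_finite[of "{..<N}"]) (use assms(2) in auto)
  then show ?thesis using assms(1) by (auto simp: mem_carr_hsum)
qed

lemma trunc_mem_carr: "(\<And>n. f n \<in> carr (H n)) \<Longrightarrow> trunc N f \<in> carr (hsum H)"
  by (rule finite_support_mem_carr[of _ N]) (auto simp: trunc_def)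

lemma sing_mem_carr: "x \<in> carr (H n) \<Longrightarrow> sing n x \<in> carr (hsum H)"
  by (rule finite_support_mem_carr[of _ "Suc n"]) (auto simp: sing_def)

lemma ip_sing_left: "x \<in> carr (H n) \<Longrightarrow> (\<And>m. g m \<in> carr (H m)) \<Longrightarrow>
    ip (hsum H) (sing n x) g = ip (H n) x (g n)"
proof -
  assume a: "x \<in> carr (H n)" "\<And>m. g m \<in> carr (H m)"
  have "(\<lambda>m. ip (H m) (sing n x m) (g m)) = (\<lambda>m. if m = n then ip (H m) x (g m) else 0)"
    using a by (auto simp: sing_def)
  then show ?thesis using sums_single[of n "\<lambda>m. ip (H m) x (g m)"] by (simp add: ip_hsum sums_iff)
qed

lemma nrm_sing: "x \<in> carr (H n) \<Longrightarrow> nrm (hsum H) (sing n x) = nrm (H n) x"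
  using ip_sing_left[of x n "sing n x"] sing_mem_carr[of x n] by (simp add: nrm_def mem_carr_hsum)

lemma trunc_tendsto:
  assumes f: "f \<in> carr (hsum H)"
  shows "(\<lambda>N. nrm (hsum H) (f - trunc N f)) \<longlonglongrightarrow> 0"
proof -
  let ?a = "\<lambda>n. (nrm (H n) (f n))\<^sup>2"
  have fc: "f n \<in> carr (H n)" for n using f by (auto simp: mem_carr_hsum)
  note s = nrm_hsum_sums[OF f]
  have "(\<lambda>n. ?a n - (if n \<in> {..<N} then ?a n else 0)) sums ((nrm (hsum H) f)\<^sup>2 - sum ?a {..<N})" for N
    by (intro sums_diff s sums_If_finite_set) simp
  moreover have "(\<lambda>n. ?a n - (if n \<in> {..<N} then ?a n else 0)) = (\<lambda>n. (nrm (H n) ((f - trunc N f) n))\<^sup>2)" for N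
    by (auto simp: trunc_def fun_eq_iff)
  ultimately have "(nrm (hsum H) (f - trunc N f))\<^sup>2 = (nrm (hsum H) f)\<^sup>2 - sum ?a {..<N}" for N
    using nrm_hsum_sums[of "f - trunc N f"] trunc_mem_carr[of f, OF fc] f by (simp add: sums_unique2)
  moreover have "(\<lambda>N. (nrm (hsum H) f)\<^sup>2 - sum ?a {..<N}) \<longlonglongrightarrow> (nrm (hsum H) f)\<^sup>2 - (nrm (hsum H) f)\<^sup>2"
    using s unfolding sums_def by (intro tendsto_diff tendsto_const)
  ultimately have "(\<lambda>N. sqrt ((nrm (hsum H) (f - trunc N f))\<^sup>2)) \<longlonglongrightarrow> sqrt 0"
    by (intro tendsto_real_sqrt) simp
  then show ?thesis using f trunc_mem_carr[of f, OF fc] by simp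
qed

text \<open>Two approximations are combined, each with half of the error: truncation of
  \<open>x\<close>, and replacement of the remaining components by elements of the
  \<open>D n\<close>. Applied to the domains of the \<open>S n\<close>, it yields density of the
  domains of the restricted operators.\<close>

lemma finite_support_dense:
  assumes D: "\<And>n. hdense (H n) (D n)" and 0: "\<And>n. 0 \<in> D n"
  shows "hdense (hsum H) {f. (\<forall>n. f n \<in> D n) \<and> (\<exists>N. \<forall>n\<ge>N. f n = 0)}" (is "hdense _ ?F")
proof -
  have Dc: "D n \<subseteq> carr (H n)" for n using D by (simp add: hdense_def)
  have sub: "?F \<subseteq> carr (hsum H)" using finite_support_mem_carr Dc by blast
  have "x \<in> hclosure (hsum H) ?F" if x: "x \<in> carr (hsum H)" for x
  proof -
    have xc: "x n \<in> carr (H n)" for n using x by (auto simp: mem_carr_hsum)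
    note tc = trunc_mem_carr[of x, OF xc]
    have "\<exists>y\<in>?F. nrm (hsum H) (x - y) < e" if e: "e > 0" for e
    proof -
      obtain N where N: "norm (nrm (hsum H) (x - trunc N x) - 0) < e / 2"
        using LIMSEQ_D[OF trunc_tendsto[OF x] half_gt_zero[OF e]] by blast
      \<comment> \<open>The error budget of component \<open>n\<close>: the weights
        \<open>(1/2) ^ Suc n\<close> sum to 1, so the squared errors sum to
        \<open>(e / 2)\<^sup>2\<close>, independently of \<open>N\<close>.\<close>
      define d where "d = (\<lambda>n. (e / 2) * sqrt ((1/2) ^ Suc n))"
      have "\<exists>y\<in>D n. nrm (H n) (x n - y) < d n" for n
      proof -
        have "x n \<in> hclosure (H n) (D n)" "d n > 0" using D[of n] xc[of n] e by (auto simp: hdense_def d_def)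
        then show ?thesis by (auto simp: hclosure_def)
      qed
      then obtain y where y: "\<And>n. y n \<in> D n" "\<And>n. nrm (H n) (x n - y n) < d n" by metis
      have yc: "y n \<in> carr (H n)" for n using y Dc by auto
      note t = trunc_mem_carr[of y, OF yc] trunc_mem_carr[of x, OF xc]
      have "(nrm (hsum H) (trunc N x - trunc N y))\<^sup>2 \<le> (e / 2)\<^sup>2"
      proof (rule sums_le)
        show "(\<lambda>n. (nrm (H n) ((trunc N x - trunc N y) n))\<^sup>2) sums (nrm (hsum H) (trunc N x - trunc N y))\<^sup>2"
          by (intro nrm_hsum_sums s.diff_mem t)
        show "(\<lambda>n. (d n)\<^sup>2) sums (e / 2)\<^sup>2"
          using sums_mult[OF power_half_series, of "(e/2)\<^sup>2"]
          by (simp only: d_def power_mult_distrib real_sqrt_pow2 zero_le_power) simp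
        show "(nrm (H n) ((trunc N x - trunc N y) n))\<^sup>2 \<le> (d n)\<^sup>2" for n
        proof (cases "n < N")
          case True
          then show ?thesis using y(2)[of n] xc yc by (auto simp: trunc_def intro!: power_mono)
        qed (simp add: trunc_def)
      qed
      then have "nrm (hsum H) (trunc N x - trunc N y) \<le> e / 2"
        by (rule power2_le_imp_le) (use e in simp)
      then have "nrm (hsum H) (x - trunc N y) < e"
        using s.nrm_diff_triangle[of x "trunc N x" "trunc N y"] x t N by simp
      moreover have "trunc N y \<in> ?F" using y 0 by (auto simp: trunc_def intro!: exI[of _ N])
      ultimately show ?thesis by blast
    qed
    then show ?thesis using x by (simp add: hclosure_def)
  qed
  then have "hclosure (hsum H) ?F = carr (hsum H)"
    by (intro equalityI s.hclosure_subset) (rule subsetI)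
  with sub show ?thesis unfolding hdense_def by (rule conjI)
qed

end

subsection \<open>Direct sums of relations\<close>

lemma linear_operator_op_sum:
  assumes "pre_hilbert_seq H" "pre_hilbert_seq K" "\<And>n. linear_operator (H n) (K n) (T n)"
  shows "linear_operator (hsum H) (hsum K) (op_sum H K T)"
proof -
  interpret H: pre_hilbert_seq H by fact
  interpret K: pre_hilbert_seq K by fact
  note T = linear_operatorD[OF assms(3)]
  have "single_valued (op_sum H K T)"
    using T(3) by (auto simp: single_valued_def mem_op_sum fun_eq_iff) blast
  moreover have "complex_vector.subspace (op_sum H K T)"
  proof (rule subspace_prodI)
    show "(0, 0) \<in> op_sum H K T"
      using subspace_prodD(1)[OF T(2)] by (simp add: mem_op_sum)
    show "(x + x', y + y') \<in> op_sum H K T" if "(x, y) \<in> op_sum H K T" "(x', y') \<in> op_sum H K T" for x y x' y'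
    proof -
      have "x + x' \<in> carr (hsum H)" "y + y' \<in> carr (hsum K)"
        using that by (auto simp: mem_op_sum intro: H.s.add_mem K.s.add_mem)
      moreover have "((x + x') n, (y + y') n) \<in> T n" for n
        using that subspace_prodD(2)[OF T(2), of "x n" "y n" n "x' n" "y' n"] by (simp add: mem_op_sum)
      ultimately show ?thesis by (simp only: mem_op_sum) blast
    qed
    show "(a *\<^sub>C x, a *\<^sub>C y) \<in> op_sum H K T" if "(x, y) \<in> op_sum H K T" for a x y
    proof -
      have "a *\<^sub>C x \<in> carr (hsum H)" "a *\<^sub>C y \<in> carr (hsum K)" using that by (auto simp: mem_op_sum)
      moreover have "((a *\<^sub>C x) n, (a *\<^sub>C y) n) \<in> T n" for n
        using that subspace_prodD(4)[OF T(2), of "x n" "y n" n a] by (simp add: mem_op_sum scaleC_fun_def)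
      ultimately show ?thesis by (simp add: mem_op_sum)
    qed
  qed
  ultimately show ?thesis by (auto simp: linear_operator_def linear_relation_def mem_op_sum)
qed

lemma sing_mem_op_sum:
  assumes "pre_hilbert_seq H" "pre_hilbert_seq K" "\<And>n. T n \<subseteq> carr (H n) \<times> carr (K n)" "\<And>n. (0, 0) \<in> T n"
    "(x, y) \<in> T n"
  shows "(sing n x, sing n y) \<in> op_sum H K T"
  using assms(3)[of n] assms(4,5) pre_hilbert_seq.sing_mem_carr[OF assms(1), of x n]
    pre_hilbert_seq.sing_mem_carr[OF assms(2), of y n]
  by (auto simp: mem_op_sum sing_def)

lemma trunc_mem_op_sum:
  assumes "pre_hilbert_seq H" "pre_hilbert_seq K" "\<And>n. T n \<subseteq> carr (H n) \<times> carr (K n)" "\<And>n. (0, 0) \<in> T n"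
    "\<And>n. (f n, g n) \<in> T n"
  shows "(trunc N f, trunc N g) \<in> op_sum H K T"
proof -
  have "f n \<in> carr (H n)" "g n \<in> carr (K n)" for n using assms(3)[of n] assms(5)[of n] by auto
  then have "trunc N f \<in> carr (hsum H)" "trunc N g \<in> carr (hsum K)"
    using assms(1,2) by (auto intro: pre_hilbert_seq.trunc_mem_carr)
  then show ?thesis using assms(4,5) by (auto simp: mem_op_sum trunc_def)
qed

text \<open>Vectors supported at one index give the componentwise adjoint relations; conversely
  these give termwise equal series. No summability is lost or gained, because both sides demand it
  of \<open>g\<close> and \<open>g'\<close> from the start.\<close>

lemma adj_op_sum:
  assumes "pre_hilbert_seq H" and T: "\<And>n. T n \<subseteq> carr (H n) \<times> carr (H n)" and 0: "\<And>n. (0, 0) \<in> T n"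
  shows "adj (hsum H) (op_sum H H T) = op_sum H H (\<lambda>n. adj (H n) (T n))"
proof -
  interpret H: pre_hilbert_seq H by fact
  have "(g, g') \<in> adj (hsum H) (op_sum H H T) \<longleftrightarrow> (g, g') \<in> op_sum H H (\<lambda>n. adj (H n) (T n))" for g g'
  proof
    assume L: "(g, g') \<in> adj (hsum H) (op_sum H H T)"
    then have c: "g \<in> carr (hsum H)" "g' \<in> carr (hsum H)" by (auto simp: H.s.mem_adj)
    then have cn: "g n \<in> carr (H n)" "g' n \<in> carr (H n)" for n by (auto simp: mem_carr_hsum)
    have "ip (H n) f' (g n) = ip (H n) f (g' n)" if f: "(f, f') \<in> T n" for n f f'
    proof -
      have "ip (hsum H) (sing n f') g = ip (hsum H) (sing n f) g'"
        using sing_mem_op_sum[OF assms(1,1) T 0 f] L unfolding H.s.mem_adj by blast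
      then show ?thesis using f T[of n] cn by (subst (asm) (1 2) H.ip_sing_left) auto
    qed
    then show "(g, g') \<in> op_sum H H (\<lambda>n. adj (H n) (T n))"
      using c cn by (auto simp: mem_op_sum H.c.mem_adj)
  next
    assume "(g, g') \<in> op_sum H H (\<lambda>n. adj (H n) (T n))"
    then show "(g, g') \<in> adj (hsum H) (op_sum H H T)"
      by (auto simp: mem_op_sum H.c.mem_adj H.s.mem_adj ip_hsum intro!: suminf_cong)
  qed
  then show ?thesis by auto
qed

text \<open>Every component norm is dominated by the norm of the sum, so an approximation in the sum
  is one in each component, where closedness applies. Square summability of the limit is part of
  lying in the ambient product.\<close>

lemma op_sum_closed:
  assumes "pre_hilbert_seq H" "pre_hilbert_seq K" "\<And>n. closed_relation (H n) (K n) (T n)"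
  shows "closed_relation (hsum H) (hsum K) (op_sum H K T)"
proof -
  interpret H: pre_hilbert_seq H by fact
  interpret K: pre_hilbert_seq K by fact
  interpret P: pre_hilbert "hsum H \<oplus>\<^sub>H hsum K"
    by (intro pre_hilbert_hprod H.s.pre_hilbert_axioms K.s.pre_hilbert_axioms)
  have s: "op_sum H K T \<subseteq> carr (hsum H) \<times> carr (hsum K)" by (auto simp: mem_op_sum)
  have cl: "hclosure (H n \<oplus>\<^sub>H K n) (T n) = T n" for n using assms(3) by (simp add: closed_relation_def hclosed_def)
  then have Tc: "T n \<subseteq> carr (H n) \<times> carr (K n)" for n
    by (metis carr_hprod pre_hilbert.hclosure_subset pre_hilbert_hprod H.comp K.comp)
  show ?thesis unfolding closed_relation_def
  proof (rule P.hclosedI)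
    show "hclosure (hsum H \<oplus>\<^sub>H hsum K) (op_sum H K T) \<subseteq> op_sum H K T"
    proof clarify
      fix f g assume "(f, g) \<in> hclosure (hsum H \<oplus>\<^sub>H hsum K) (op_sum H K T)"
      note fg = this[unfolded mem_hclosure_hprod[OF H.s.pre_hilbert_axioms K.s.pre_hilbert_axioms s]]
      have "(f n, g n) \<in> hclosure (H n \<oplus>\<^sub>H K n) (T n)" for n
        unfolding mem_hclosure_hprod[OF H.comp K.comp Tc]
      proof (intro conjI allI impI)
        show "f n \<in> carr (H n)" "g n \<in> carr (K n)" using fg by (auto simp: mem_carr_hsum)
        fix e :: real assume e: "e > 0"
        then obtain a b where ab: "(a, b) \<in> op_sum H K T" "nrm (hsum H) (f - a) < e" "nrm (hsum K) (g - b) < e"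
          using fg by blast
        have "f - a \<in> carr (hsum H)" "g - b \<in> carr (hsum K)"
          using ab(1) fg s by (auto intro: H.s.diff_mem K.s.diff_mem)
        then have "nrm (H n) ((f - a) n) < e" "nrm (K n) ((g - b) n) < e"
          using H.nrm_component_le[of "f - a" n] K.nrm_component_le[of "g - b" n] ab by linarith+
        then show "\<exists>(a, b)\<in>T n. nrm (H n) (f n - a) < e \<and> nrm (K n) (g n - b) < e"
          using ab(1) by (intro bexI[of _ "(a n, b n)"]) (auto simp: mem_op_sum)
      qed
      then show "(f, g) \<in> op_sum H K T" using fg cl by (simp add: mem_op_sum)
    qed
  qed (use s in simp)
qed

text \<open>Only the truncations have to lie in \<open>D\<close>, which itself need not be a direct
  sum. It serves both for the range of the joint boundary map and for the restricted
  operators.\<close>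

lemma op_sum_subset_closure:
  assumes "pre_hilbert_seq H" "pre_hilbert_seq K" and T: "\<And>n. T n \<subseteq> carr (H n) \<times> carr (K n)"
    and trunc: "\<And>f g N. (f, g) \<in> op_sum H K T \<Longrightarrow> (trunc N f, trunc N g) \<in> D"
    and D: "D \<subseteq> carr (hsum H) \<times> carr (hsum K)"
  shows "op_sum H K T \<subseteq> rel_closure (hsum H) (hsum K) D"
proof clarify
  interpret H: pre_hilbert_seq H by fact
  interpret K: pre_hilbert_seq K by fact
  fix f g assume fg: "(f, g) \<in> op_sum H K T"
  then have c: "f \<in> carr (hsum H)" "g \<in> carr (hsum K)" by (auto simp: mem_op_sum)
  show "(f, g) \<in> rel_closure (hsum H) (hsum K) D"
    unfolding rel_closure_def mem_hclosure_hprod[OF H.s.pre_hilbert_axioms K.s.pre_hilbert_axioms D]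
  proof (intro conjI allI impI c)
    fix e :: real assume e: "e > 0"
    have "eventually (\<lambda>N. nrm (hsum H) (f - trunc N f) < e \<and> nrm (hsum K) (g - trunc N g) < e) sequentially"
      using order_tendstoD(2)[OF H.trunc_tendsto[OF c(1)] e] order_tendstoD(2)[OF K.trunc_tendsto[OF c(2)] e]
      by (rule eventually_conj)
    then obtain N where "nrm (hsum H) (f - trunc N f) < e \<and> nrm (hsum K) (g - trunc N g) < e"
      by (auto simp: eventually_sequentially)
    then show "\<exists>(a, b)\<in>D. nrm (hsum H) (f - a) < e \<and> nrm (hsum K) (g - b) < e"
      using trunc[OF fg, of N] by blast
  qed
qed

section \<open>Direct sums of bounded operators\<close>

lemma op_norm_le_imp_bound:
  assumes "pre_hilbert H" "pre_hilbert K" and T: "linear_operator H K T"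
    and c: "op_norm H K T \<le> ereal c" and xy: "(x, y) \<in> T"
  shows "nrm K y \<le> c * nrm H x"
proof -
  interpret H: pre_hilbert H by fact
  interpret K: pre_hilbert K by fact
  note T = linear_operatorD[OF T]
  have x: "x \<in> carr H" and y: "y \<in> carr K" using T(1) xy by auto
  show ?thesis
  proof (cases "x = 0")
    case True
    then have "y = 0" using xy subspace_prodD(1)[OF T(2)] T(3) by (auto dest: single_valuedD)
    then show ?thesis using True by simp
  next
    case False
    then have p: "nrm H x > 0" using H.nrm_eq_0[OF x] H.nrm_nonneg[OF x] by linarith
    define r where "r = complex_of_real (1 / nrm H x)"
    have r: "cmod r = 1 / nrm H x" unfolding r_def using p by (simp only: norm_of_real) simp
    have m: "(r *\<^sub>C x, r *\<^sub>C y) \<in> T" by (rule subspace_prodD(4)[OF T(2) xy])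
    have "nrm H (r *\<^sub>C x) \<le> 1" using p by (simp add: H.nrm_scale[OF x] r)
    then have "ereal (nrm K (r *\<^sub>C y)) \<le> op_norm H K T"
      unfolding op_norm_def using m by (intro SUP_upper2[of "(r *\<^sub>C x, r *\<^sub>C y)"]) auto
    also note c
    finally have "nrm K y / nrm H x \<le> c" by (simp add: K.nrm_scale[OF y] r)
    then show ?thesis using p by (simp add: field_simps)
  qed
qed

lemma op_norm_le:
  assumes "\<And>x y. (x, y) \<in> T \<Longrightarrow> nrm H x \<le> 1 \<Longrightarrow> nrm K y \<le> c"
  shows "op_norm H K T \<le> ereal c"
  unfolding op_norm_def using assms by (intro SUP_least) auto

text \<open>In the application \<open>H n\<close> is the graph space of the adjoint of
  \<open>S n\<close> and \<open>T n\<close> is one of its two boundary maps. Each \<open>T n\<close>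
  is bounded on the whole of \<open>H n\<close>, but no uniform bound is assumed.\<close>

locale bounded_operator_seq = H: pre_hilbert_seq H + K: pre_hilbert_seq K
  for H :: "nat \<Rightarrow> 'a::complex_vector hspace" and K :: "nat \<Rightarrow> 'b::complex_vector hspace" +
  fixes T :: "nat \<Rightarrow> ('a \<times> 'b) set"
  assumes bounded: "\<And>n. bounded_operator (H n) (K n) (T n)"
    and dom: "\<And>n. Domain (T n) = carr (H n)"
begin

abbreviation "norm_sup \<equiv> SUP n. op_norm (H n) (K n) (T n)"

lemma lin: "linear_operator (H n) (K n) (T n)"
  using bounded by (simp add: bounded_operator_def)

lemmas comp_op = linear_operatorD[OF lin]

lemma op_sum_subset: "op_sum H K T \<subseteq> carr (hsum H) \<times> carr (hsum K)"
  by (auto simp: mem_op_sum)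

lemma op_sum_linear: "linear_operator (hsum H) (hsum K) (op_sum H K T)"
  by (rule linear_operator_op_sum[OF H.pre_hilbert_seq_axioms K.pre_hilbert_seq_axioms lin])

lemma op_sum_is_closed: "closed_relation (hsum H) (hsum K) (op_sum H K T)"
  by (intro op_sum_closed H.pre_hilbert_seq_axioms K.pre_hilbert_seq_axioms
      bounded_operator_closed H.comp K.comp bounded dom)

lemma norm_sup_finiteD:
  assumes "norm_sup < \<infinity>"
  obtains c where "c \<ge> 0" "\<And>n x y. (x, y) \<in> T n \<Longrightarrow> nrm (K n) y \<le> c * nrm (H n) x"
proof -
  obtain c where c: "norm_sup \<le> ereal c"
    using assms by (cases norm_sup) auto
  have "nrm (K n) y \<le> max c 0 * nrm (H n) x" if "(x, y) \<in> T n" for n x y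
  proof (rule op_norm_le_imp_bound[OF H.comp K.comp lin _ that])
    have "op_norm (H n) (K n) (T n) \<le> norm_sup" by (rule SUP_upper) simp
    also have "\<dots> \<le> ereal (max c 0)" using c by (rule order_trans) simp
    finally show "op_norm (H n) (K n) (T n) \<le> ereal (max c 0)" .
  qed
  then show ?thesis by (intro that[of "max c 0"]) auto
qed

lemma norm_sup_finiteI:
  assumes "\<And>n x y. (x, y) \<in> T n \<Longrightarrow> nrm (H n) x \<le> 1 \<Longrightarrow> nrm (K n) y \<le> c"
  shows "norm_sup < \<infinity>"
proof -
  have "norm_sup \<le> ereal c" using assms by (intro SUP_least op_norm_le)
  then show ?thesis by (rule order_le_less_trans) simp
qed

text \<open>A common bound \<open>c\<close> turns square summability of \<open>f\<close> into that
  of its image; summing the squares shows that the same \<open>c\<close> bounds the direct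
  sum.\<close>

lemma norm_sup_finite_imp:
  assumes "norm_sup < \<infinity>"
  shows "Domain (op_sum H K T) = carr (hsum H)" "bounded_operator (hsum H) (hsum K) (op_sum H K T)"
proof -
  obtain c where c: "c \<ge> 0" "\<And>n x y. (x, y) \<in> T n \<Longrightarrow> nrm (K n) y \<le> c * nrm (H n) x"
    using norm_sup_finiteD[OF assms] by blast
  have c2: "(nrm (K n) y)\<^sup>2 \<le> c\<^sup>2 * (nrm (H n) x)\<^sup>2" if "(x, y) \<in> T n" for n x y
    using power_mono[OF c(2)[OF that], of 2] comp_op(1)[of n] that by (auto simp: power_mult_distrib)
  have "f \<in> Domain (op_sum H K T)" if f: "f \<in> carr (hsum H)" for f
  proof -
    have "\<exists>y. (f n, y) \<in> T n" for n using f dom[of n] by (auto simp: mem_carr_hsum)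
    then obtain g where g: "\<And>n. (f n, g n) \<in> T n" by metis
    have "summable (\<lambda>n. (nrm (K n) (g n))\<^sup>2)"
    proof (rule summable_comparison_test')
      show "summable (\<lambda>n. c\<^sup>2 * (nrm (H n) (f n))\<^sup>2)"
        using f by (intro summable_mult) (simp add: mem_carr_hsum)
      show "norm ((nrm (K n) (g n))\<^sup>2) \<le> c\<^sup>2 * (nrm (H n) (f n))\<^sup>2" for n
        using c2[OF g[of n]] by simp
    qed
    moreover have "g n \<in> carr (K n)" for n using g[of n] comp_op(1)[of n] by auto
    ultimately have "(f, g) \<in> op_sum H K T" using f g by (simp add: mem_op_sum mem_carr_hsum)
    then show ?thesis by blast
  qed
  then show "Domain (op_sum H K T) = carr (hsum H)" using op_sum_subset by blast
  have "nrm (hsum K) g \<le> c * nrm (hsum H) f" if "(f, g) \<in> op_sum H K T" for f g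
  proof (rule power2_le_imp_le)
    have fg: "f \<in> carr (hsum H)" "g \<in> carr (hsum K)" "\<And>n. (f n, g n) \<in> T n" using that by (auto simp: mem_op_sum)
    show "(nrm (hsum K) g)\<^sup>2 \<le> (c * nrm (hsum H) f)\<^sup>2"
      unfolding power_mult_distrib
      by (rule sums_le[OF c2[OF fg(3)] K.nrm_hsum_sums[OF fg(2)] sums_mult[OF H.nrm_hsum_sums[OF fg(1)]]])
    show "0 \<le> c * nrm (hsum H) f" using c(1) fg(1) by simp
  qed
  then show "bounded_operator (hsum H) (hsum K) (op_sum H K T)"
    unfolding bounded_operator_def using op_sum_linear by blast
qed

lemma bounded_imp_norm_sup_finite:
  assumes "bounded_operator (hsum H) (hsum K) (op_sum H K T)"
  shows "norm_sup < \<infinity>"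
proof -
  obtain c where c: "\<And>f g. (f, g) \<in> op_sum H K T \<Longrightarrow> nrm (hsum K) g \<le> c * nrm (hsum H) f"
    using assms by (auto simp: bounded_operator_def)
  show ?thesis
  proof (rule norm_sup_finiteI)
    fix n x y assume xy: "(x, y) \<in> T n" "nrm (H n) x \<le> 1"
    have m: "x \<in> carr (H n)" "y \<in> carr (K n)" using xy comp_op(1)[of n] by auto
    have "(sing n x, sing n y) \<in> op_sum H K T"
      by (rule sing_mem_op_sum[OF H.pre_hilbert_seq_axioms K.pre_hilbert_seq_axioms comp_op(1)
            subspace_prodD(1)[OF comp_op(2)] xy(1)])
    from c[OF this] have "nrm (K n) y \<le> c * nrm (H n) x" using m by (simp add: H.nrm_sing K.nrm_sing)
    also have "\<dots> \<le> \<bar>c\<bar> * 1" using m xy(2) by (intro mult_mono) auto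
    finally show "nrm (K n) y \<le> \<bar>c\<bar>" by simp
  qed
qed

text \<open>A gliding hump: unit vectors in distinct components with images of norm above \<open>k + 1\<close>,
  weighted by \<open>1 / (k + 1)\<close>, form a square summable sequence whose images do not tend to zero.\<close>

lemma full_domain_imp_norm_sup_finite:
  assumes full: "Domain (op_sum H K T) = carr (hsum H)"
  shows "norm_sup < \<infinity>"
proof (rule ccontr)
  assume inf: "\<not> norm_sup < \<infinity>"
  define P where "P r n \<longleftrightarrow> (\<exists>x y. (x, y) \<in> T n \<and> nrm (H n) x \<le> 1 \<and> nrm (K n) y > r)" for r :: real and n
  \<comment> \<open>Large values occur beyond every index: each \<open>T n\<close> is bounded on its
    own, so if only the components below \<open>m\<close> exceeded \<open>r\<close>, the sum of
    their finitely many bounds together with \<open>\<bar>r\<bar>\<close> would bound all of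
    them.\<close>
  have ex: "\<exists>n\<ge>m. P r n" for m r
  proof (rule ccontr)
    assume neg: "\<not> (\<exists>n\<ge>m. P r n)"
    have "\<exists>c\<ge>0. \<forall>x y. (x, y) \<in> T n \<longrightarrow> nrm (H n) x \<le> 1 \<longrightarrow> nrm (K n) y \<le> c" for n
    proof -
      obtain c where c: "\<And>x y. (x, y) \<in> T n \<Longrightarrow> nrm (K n) y \<le> c * nrm (H n) x"
        using bounded[of n] by (auto simp: bounded_operator_def)
      have "nrm (K n) y \<le> \<bar>c\<bar>" if xy: "(x, y) \<in> T n" "nrm (H n) x \<le> 1" for x y
      proof -
        have "nrm (K n) y \<le> c * nrm (H n) x" by (rule c[OF xy(1)])
        also have "\<dots> \<le> \<bar>c\<bar> * 1" using xy comp_op(1)[of n] by (intro mult_mono) auto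
        finally show ?thesis by simp
      qed
      then show ?thesis by (intro exI[of _ "\<bar>c\<bar>"]) auto
    qed
    then obtain c where c: "\<And>n. c n \<ge> (0::real)"
      "\<And>n x y. (x, y) \<in> T n \<Longrightarrow> nrm (H n) x \<le> 1 \<Longrightarrow> nrm (K n) y \<le> c n" by metis
    have "norm_sup < \<infinity>"
    proof (rule norm_sup_finiteI)
      fix n x y assume xy: "(x, y) \<in> T n" "nrm (H n) x \<le> 1"
      show "nrm (K n) y \<le> \<bar>r\<bar> + sum c {..<m}"
      proof (cases "n < m")
        case True
        then have "c n \<le> sum c {..<m}" using c(1) by (intro member_le_sum) auto
        then show ?thesis using c(2)[OF xy] by linarith
      next
        case False
        then have "nrm (K n) y \<le> r" using neg xy unfolding P_def by (meson not_le)
        moreover have "0 \<le> sum c {..<m}" by (intro sum_nonneg c(1))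
        ultimately show ?thesis by linarith
      qed
    qed
    then show False using inf by simp
  qed
  have "\<exists>\<phi>. \<forall>k. P (real k + 1) (\<phi> k) \<and> \<phi> k < \<phi> (Suc k)"
  proof (rule dependent_nat_choice)
    show "\<exists>n. P (real 0 + 1) n" using ex by blast
    show "\<exists>n'. P (real (Suc k) + 1) n' \<and> n < n'" for n k
      using ex[of "Suc n" "real (Suc k) + 1"] by (auto simp: Suc_le_eq)
  qed
  then obtain \<phi> where \<phi>: "\<And>k. P (real k + 1) (\<phi> k)" "strict_mono \<phi>"
    by (auto simp: strict_mono_Suc_iff)
  obtain x y where xy: "\<And>k. (x k, y k) \<in> T (\<phi> k)" "\<And>k. nrm (H (\<phi> k)) (x k) \<le> 1"
    "\<And>k. nrm (K (\<phi> k)) (y k) > real k + 1"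
    using \<phi>(1) unfolding P_def by metis
  define r where "r k = complex_of_real (1 / (real k + 1))" for k
  have r: "cmod (r k) = 1 / (real k + 1)" for k
    unfolding r_def by (simp only: norm_of_real) simp
  have inj: "inv \<phi> (\<phi> k) = k" for k using strict_mono_imp_inj_on[OF \<phi>(2)] by simp
  \<comment> \<open>The weighted hump vectors are placed at the indices \<open>\<phi> k\<close>,
    with 0 elsewhere; \<open>inv \<phi>\<close> recovers \<open>k\<close> since a strictly
    increasing map is injective.\<close>
  define f where "f n = (if n \<in> range \<phi> then r (inv \<phi> n) *\<^sub>C x (inv \<phi> n) else 0)" for n
  have f\<phi>: "f (\<phi> k) = r k *\<^sub>C x k" for k by (simp add: f_def inj)
  have xc: "x k \<in> carr (H (\<phi> k))" and yc: "y k \<in> carr (K (\<phi> k))" for k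
    using xy(1)[of k] comp_op(1)[of "\<phi> k"] by auto
  have fc: "f n \<in> carr (H n)" for n
  proof (cases "n \<in> range \<phi>")
    case True
    then obtain k where "n = \<phi> k" by blast
    then show ?thesis using xc f\<phi> by simp
  qed (simp add: f_def)
  have "summable (\<lambda>k. (nrm (H (\<phi> k)) (f (\<phi> k)))\<^sup>2)"
  proof (rule summable_comparison_test')
    show "summable (\<lambda>k. inverse ((real (Suc k))\<^sup>2))"
      using inverse_power_summable[of 2, where 'a = real] by (subst summable_Suc_iff) simp
    show "norm ((nrm (H (\<phi> k)) (f (\<phi> k)))\<^sup>2) \<le> inverse ((real (Suc k))\<^sup>2)" for k
    proof -
      have "nrm (H (\<phi> k)) (f (\<phi> k)) \<le> 1 / (real k + 1) * 1"
        unfolding f\<phi> H.c.nrm_scale[OF xc] r using xy(2) by (intro mult_left_mono) auto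
      then have "(nrm (H (\<phi> k)) (f (\<phi> k)))\<^sup>2 \<le> (1 / (real k + 1))\<^sup>2"
        using fc by (intro power_mono) auto
      then show ?thesis by (simp add: power_divide inverse_eq_divide add.commute)
    qed
  qed
  \<comment> \<open>Passing from the subsequence to all indices is legitimate because
    \<open>f\<close> vanishes off the range of \<open>\<phi>\<close>.\<close>
  then have "summable (\<lambda>n. (nrm (H n) (f n))\<^sup>2)"
    by (subst (asm) summable_mono_reindex[OF \<phi>(2)]) (auto simp: f_def)
  then have "f \<in> carr (hsum H)" using fc by (simp add: mem_carr_hsum)
  then obtain g where g: "(f, g) \<in> op_sum H K T" using full by auto
  then have "g (\<phi> k) = r k *\<^sub>C y k" for k
    using subspace_prodD(4)[OF comp_op(2) xy(1), of "r k" k] comp_op(3) f\<phi>[of k]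
    by (auto simp: mem_op_sum dest: single_valuedD) (metis single_valuedD)
  then have big: "nrm (K (\<phi> k)) (g (\<phi> k)) > 1" for k
    using xy(3)[of k] by (simp add: K.c.nrm_scale[OF yc] r field_simps)
  have "(\<lambda>n. (nrm (K n) (g n))\<^sup>2) \<longlonglongrightarrow> 0"
    using g by (intro summable_LIMSEQ_zero) (auto simp: mem_op_sum mem_carr_hsum)
  from LIMSEQ_subseq_LIMSEQ[OF this \<phi>(2)] have "(\<lambda>k. (nrm (K (\<phi> k)) (g (\<phi> k)))\<^sup>2) \<longlonglongrightarrow> 0"
    by (simp add: o_def)
  moreover have "(nrm (K (\<phi> k)) (g (\<phi> k)))\<^sup>2 \<ge> 1" for k
    using one_le_power[OF less_imp_le[OF big[of k]]] .
  then have "\<exists>N. \<forall>k\<ge>N. 1 \<le> (nrm (K (\<phi> k)) (g (\<phi> k)))\<^sup>2" by blast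
  ultimately have "(0::real) \<ge> 1" by (rule LIMSEQ_le_const)
  then show False by simp
qed

end

section \<open>Boundary triplets\<close>

text \<open>The factor \<open>\<sigma>\<close> in Green's identity makes the assumptions invariant under exchanging \<open>\<Gamma>0\<close>
  and \<open>\<Gamma>1\<close>, so that only statements about \<open>\<Gamma>0\<close> need a proof.\<close>

locale triplet = H: pre_hilbert H + G: pre_hilbert G
  for H :: "'a::complex_vector hspace" and G :: "'b::complex_vector hspace" +
  fixes S :: "('a \<times> 'a) set" and \<Gamma>0 \<Gamma>1 :: "('a \<times> 'b) set" and \<sigma> :: complex
  assumes S_sym: "closed_symmetric H S"
    and dom0: "Domain \<Gamma>0 = Domain (adj H S)" and dom1: "Domain \<Gamma>1 = Domain (adj H S)"
    and bounded0: "bounded_operator (graph_space H (adj H S)) G \<Gamma>0"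
    and bounded1: "bounded_operator (graph_space H (adj H S)) G \<Gamma>1"
    and sign: "\<sigma> \<noteq> 0"
    and green: "\<lbrakk>(f, f') \<in> adj H S; (g, g') \<in> adj H S; (f, l) \<in> \<Gamma>0; (f, l') \<in> \<Gamma>1; (g, h) \<in> \<Gamma>0; (g, h') \<in> \<Gamma>1\<rbrakk>
      \<Longrightarrow> ip H f' g - ip H f g' = \<sigma> * (ip G l' h - ip G l h')"
    and surj: "\<lbrakk>h \<in> carr G; h' \<in> carr G\<rbrakk> \<Longrightarrow> \<exists>f. (f, h) \<in> \<Gamma>0 \<and> (f, h') \<in> \<Gamma>1"
begin

lemma swap: "triplet H G S \<Gamma>1 \<Gamma>0 (- \<sigma>)"
proof
  show "\<exists>f. (f, h) \<in> \<Gamma>1 \<and> (f, h') \<in> \<Gamma>0" if "h \<in> carr G" "h' \<in> carr G" for h h'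
    using surj[OF that(2,1)] by blast
  show "ip H f' g - ip H f g' = - \<sigma> * (ip G l' h - ip G l h')"
    if "(f, f') \<in> adj H S" "(g, g') \<in> adj H S" "(f, l) \<in> \<Gamma>1" "(f, l') \<in> \<Gamma>0" "(g, h) \<in> \<Gamma>1" "(g, h') \<in> \<Gamma>0"
    for f f' g g' l l' h h'
    using green[OF that(1,2,4,3,6,5)] by (simp add: algebra_simps)
qed (use S_sym dom0 dom1 bounded0 bounded1 sign in auto)

abbreviation "T \<equiv> adj H S"
abbreviation "graph \<equiv> graph_space H T"

lemma S_op: "linear_operator H H S" "hdense H (Domain S)" "S \<subseteq> T"
  using S_sym by (auto simp: closed_symmetric_def)

lemma T_op: "linear_operator H H T"
  by (rule H.linear_operator_adj[OF linear_operatorD(1)[OF S_op(1)] S_op(2)])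

lemma pre_hilbert_graph: "pre_hilbert graph"
  by (rule pre_hilbert_graph_space[OF H.pre_hilbert_axioms T_op])

lemma boundary_op: "linear_operator graph G \<Gamma>0" "linear_operator graph G \<Gamma>1"
  using bounded0 bounded1 by (auto simp: bounded_operator_def)

lemma boundary_mem: "(f, l) \<in> \<Gamma>0 \<Longrightarrow> l \<in> carr G" "(f, l) \<in> \<Gamma>1 \<Longrightarrow> l \<in> carr G"
  using linear_operatorD(1)[OF boundary_op(1)] linear_operatorD(1)[OF boundary_op(2)] by auto

lemma boundary_zero: "(0, 0) \<in> \<Gamma>0" "(0, 0) \<in> \<Gamma>1"
  using linear_operatorD(2)[OF boundary_op(1)] linear_operatorD(2)[OF boundary_op(2)] by (auto dest: subspace_prodD(1))

lemma boundary_values: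
  assumes "(f, f') \<in> T" obtains l l' where "(f, l) \<in> \<Gamma>0" "(f, l') \<in> \<Gamma>1"
  using assms dom0 dom1 by blast

lemma surjE:
  assumes "h \<in> carr G" "h' \<in> carr G"
  obtains f f' where "(f, f') \<in> T" "(f, h) \<in> \<Gamma>0" "(f, h') \<in> \<Gamma>1"
  using surj[OF assms] dom0 by blast

text \<open>For \<open>f\<close> in the domain of \<open>S\<close> the left side of Green's identity
  vanishes against every element of the adjoint. Surjectivity makes the boundary values on the right
  arbitrary, so they can be chosen to produce the squared norms of \<open>l'\<close> and
  \<open>l\<close>.\<close>

lemma boundary_values_S:
  assumes f: "(f, f') \<in> S"
  shows "(f, 0) \<in> \<Gamma>0" "(f, 0) \<in> \<Gamma>1"
proof -
  have fT: "(f, f') \<in> T" using f S_op(3) by blast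
  obtain l l' where l: "(f, l) \<in> \<Gamma>0" "(f, l') \<in> \<Gamma>1" using boundary_values[OF fT] .
  have eq: "ip G l' h - ip G l h' = 0" if h: "h \<in> carr G" "h' \<in> carr G" for h h'
  proof -
    obtain g g' where g: "(g, g') \<in> T" "(g, h) \<in> \<Gamma>0" "(g, h') \<in> \<Gamma>1" using surjE[OF h] .
    have "ip H f' g - ip H f g' = 0" using g(1) f by (simp add: H.mem_adj)
    then show ?thesis using green[OF fT g(1) l g(2,3)] sign by simp
  qed
  note lc = boundary_mem(1)[OF l(1)] boundary_mem(2)[OF l(2)]
  have "l' = 0" using eq[of l' 0] lc G.ip_pos[of l'] by auto
  moreover have "l = 0" using eq[of 0 l] lc G.ip_pos[of l] by auto
  ultimately show "(f, 0) \<in> \<Gamma>0" "(f, 0) \<in> \<Gamma>1" using l by auto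
qed

text \<open>Condition (b) for a single triplet. Testing on \<open>S\<close>, where boundary values
  vanish, puts \<open>(g, g')\<close> into the adjoint. Subtracting the genuine Green identity for
  \<open>g\<close> then leaves boundary data orthogonal to everything, by surjectivity.\<close>

lemma maximal:
  assumes c: "g \<in> carr H" "g' \<in> carr H" "h \<in> carr G" "h' \<in> carr G"
    and all: "\<And>f f' l l'. \<lbrakk>(f, f') \<in> T; (f, l) \<in> \<Gamma>0; (f, l') \<in> \<Gamma>1\<rbrakk>
      \<Longrightarrow> ip H f' g - ip H f g' = \<sigma> * (ip G l' h - ip G l h')"
  shows "(g, g') \<in> T" "(g, h) \<in> \<Gamma>0" "(g, h') \<in> \<Gamma>1"
proof -
  have "ip H f' g = ip H f g'" if f: "(f, f') \<in> S" for f f'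
  proof -
    have "(f, f') \<in> T" using f S_op(3) by blast
    from all[OF this boundary_values_S[OF f]] show ?thesis using c by simp
  qed
  then show gT: "(g, g') \<in> T" using c by (simp add: H.mem_adj)
  obtain k k' where k: "(g, k) \<in> \<Gamma>0" "(g, k') \<in> \<Gamma>1" using boundary_values[OF gT] .
  note kc = boundary_mem(1)[OF k(1)] boundary_mem(2)[OF k(2)]
  have eq: "ip G l' k - ip G l k' = ip G l' h - ip G l h'" if l: "l \<in> carr G" "l' \<in> carr G" for l l'
  proof -
    obtain f f' where f: "(f, f') \<in> T" "(f, l) \<in> \<Gamma>0" "(f, l') \<in> \<Gamma>1" using surjE[OF l] .
    show ?thesis using all[OF f] green[OF f(1) gT f(2,3) k] sign by simp
  qed
  have "k = h" by (rule G.ip_eqI[OF kc(1) c(3)]) (use eq[of 0] kc c in simp)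
  moreover have "k' = h'" by (rule G.ip_eqI[OF kc(2) c(4)]) (use eq[of _ 0] kc c in simp)
  ultimately show "(g, h) \<in> \<Gamma>0" "(g, h') \<in> \<Gamma>1" using k by auto
qed

lemma mem_T_ker: "(f, f') \<in> T \<restriction> ker \<Gamma>0 \<longleftrightarrow> (f, f') \<in> T \<and> (f, 0) \<in> \<Gamma>0"
  by (auto simp: restr_def ker_def)

text \<open>The restriction contains \<open>S\<close>, so its adjoint lies inside \<open>T\<close>,
  and Green's identity then decides which elements of \<open>T\<close> belong to it: the form on its
  right side vanishes on pairs of elements with \<open>\<Gamma>0\<close> value 0.\<close>

lemma adj_T_ker: "adj H (T \<restriction> ker \<Gamma>0) = T \<restriction> ker \<Gamma>0"
proof -
  have "(g, g') \<in> adj H (T \<restriction> ker \<Gamma>0) \<longleftrightarrow> (g, g') \<in> T \<restriction> ker \<Gamma>0" for g g'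
  proof
    assume L: "(g, g') \<in> adj H (T \<restriction> ker \<Gamma>0)"
    have "S \<subseteq> T \<restriction> ker \<Gamma>0" using S_op(3) boundary_values_S(1) mem_T_ker by auto
    then have gT: "(g, g') \<in> T" using L unfolding H.mem_adj by blast
    obtain k k' where k: "(g, k) \<in> \<Gamma>0" "(g, k') \<in> \<Gamma>1" using boundary_values[OF gT] .
    note kc = boundary_mem(1)[OF k(1)] boundary_mem(2)[OF k(2)]
    \<comment> \<open>The test element has \<open>\<Gamma>0\<close> value 0, hence is admissible,
      and its \<open>\<Gamma>1\<close> value is the \<open>\<Gamma>0\<close> value \<open>k\<close>
      of \<open>g\<close>; Green's identity then reduces to \<open>ip G k k = 0\<close>.\<close>
    obtain f f' where f: "(f, f') \<in> T" "(f, 0) \<in> \<Gamma>0" "(f, k) \<in> \<Gamma>1" using surjE[OF G.zero_mem kc(1)] .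
    have "ip H f' g = ip H f g'" using L f by (simp add: H.mem_adj mem_T_ker)
    then have "ip G k k = 0" using green[OF f(1) gT f(2,3) k] sign kc by simp
    then have "k = 0" using G.ip_pos[OF kc(1)] by fastforce
    then show "(g, g') \<in> T \<restriction> ker \<Gamma>0" using gT k by (simp add: mem_T_ker)
  next
    assume R: "(g, g') \<in> T \<restriction> ker \<Gamma>0"
    then have gT: "(g, g') \<in> T" "(g, 0) \<in> \<Gamma>0" by (auto simp: mem_T_ker)
    obtain k' where k: "(g, k') \<in> \<Gamma>1" using boundary_values[OF gT(1)] by blast
    have "ip H f' g = ip H f g'" if f: "(f, f') \<in> T" "(f, 0) \<in> \<Gamma>0" for f f'
    proof -
      obtain l' where l: "(f, l') \<in> \<Gamma>1" using f(1) dom1 by blast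
      show ?thesis using green[OF f(1) gT(1) f(2) l gT(2) k] boundary_mem(2)[OF l] boundary_mem(2)[OF k] by simp
    qed
    then show "(g, g') \<in> adj H (T \<restriction> ker \<Gamma>0)"
      using gT linear_operatorD(1)[OF T_op] by (auto simp: H.mem_adj mem_T_ker)
  qed
  then show ?thesis by auto
qed

text \<open>Green's identity for a defect element and itself; off the real axis it makes a sequence of
  defect elements square summable as soon as their boundary values are.\<close>

lemma defect_bound:
  assumes f: "(f, z *\<^sub>C f) \<in> T" "(f, h) \<in> \<Gamma>0" "(f, h') \<in> \<Gamma>1"
  shows "cmod (z - cnj z) * (nrm H f)\<^sup>2 \<le> cmod \<sigma> * ((nrm G h)\<^sup>2 + (nrm G h')\<^sup>2)"
proof -
  have fc: "f \<in> carr H" using f(1) by (simp add: H.mem_adj)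
  note hc = boundary_mem(1)[OF f(2)] boundary_mem(2)[OF f(3)]
  have "ip H (z *\<^sub>C f) f - ip H f (z *\<^sub>C f) = (z - cnj z) * of_real ((nrm H f)\<^sup>2)"
    using fc by (simp add: H.ip_scale_left H.ip_scale_right H.ip_self algebra_simps)
  then have "cmod (z - cnj z) * (nrm H f)\<^sup>2 = cmod (\<sigma> * (ip G h' h - ip G h h'))"
    using green[OF f(1) f(1) f(2,3) f(2,3)] by (simp add: norm_mult norm_power fc flip: of_real_power)
  also have "\<dots> \<le> cmod \<sigma> * (cmod (ip G h' h) + cmod (ip G h h'))"
    unfolding norm_mult by (intro mult_left_mono norm_triangle_ineq4) simp
  also have "\<dots> \<le> cmod \<sigma> * (nrm G h' * nrm G h + nrm G h * nrm G h')"
    using hc by (intro mult_left_mono add_mono G.Cauchy_Schwarz) auto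
  also have "\<dots> \<le> cmod \<sigma> * ((nrm G h)\<^sup>2 + (nrm G h')\<^sup>2)"
    using zero_le_power2[of "nrm G h - nrm G h'"]
    by (intro mult_left_mono) (auto simp: power2_eq_square algebra_simps)
  finally show ?thesis .
qed

end

text \<open>Passes from Green's identity in terms of \<open>app\<close> to one about pairs in the
  graphs, which single-valuedness permits. The given order of the maps corresponds to the sign
  1.\<close>

lemma boundary_triplet_imp_triplet:
  assumes "pre_hilbert H" "closed_symmetric H S" and bt: "boundary_triplet H S G \<Gamma>0 \<Gamma>1"
  shows "triplet H G S \<Gamma>0 \<Gamma>1 1"
proof -
  interpret H: pre_hilbert H by fact
  interpret G: pre_hilbert G
    using bt by (intro hilbert_space_imp_pre_hilbert) (simp add: boundary_triplet_def)
  have T: "single_valued (adj H S)"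
    using assms(2) by (intro linear_operatorD(3)[OF H.linear_operator_adj])
      (auto simp: closed_symmetric_def dest: linear_operatorD(1))
  have \<Gamma>: "single_valued \<Gamma>0" "single_valued \<Gamma>1"
    using bt by (auto simp: boundary_triplet_def bounded_operator_def dest: linear_operatorD(3))
  show ?thesis
  proof
    fix f f' g g' l l' h h'
    assume a: "(f, f') \<in> adj H S" "(g, g') \<in> adj H S" "(f, l) \<in> \<Gamma>0" "(f, l') \<in> \<Gamma>1" "(g, h) \<in> \<Gamma>0" "(g, h') \<in> \<Gamma>1"
    have "f \<in> Domain (adj H S)" "g \<in> Domain (adj H S)" using a by auto
    then have "ip H (app (adj H S) f) g - ip H f (app (adj H S) g) =
        ip G (app \<Gamma>1 f) (app \<Gamma>0 g) - ip G (app \<Gamma>0 f) (app \<Gamma>1 g)"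
      using bt unfolding boundary_triplet_def by blast
    then show "ip H f' g - ip H f g' = 1 * (ip G l' h - ip G l h')"
      using a by (simp add: app_eq[OF T] app_eq[OF \<Gamma>(1)] app_eq[OF \<Gamma>(2)])
  qed (use assms(2) bt in \<open>auto simp: boundary_triplet_def\<close>)
qed

section \<open>Direct sums of boundary triplets\<close>

lemma linear_operator_cong:
  "carr H = carr H' \<Longrightarrow> linear_operator H K T \<longleftrightarrow> linear_operator H' K T"
  by (simp add: linear_operator_def linear_relation_def)

lemma mem_restr: "(x, y) \<in> T \<restriction> D \<longleftrightarrow> (x, y) \<in> T \<and> x \<in> D"
  by (auto simp: restr_def)

lemma mem_ker: "x \<in> ker T \<longleftrightarrow> (x, 0) \<in> T"
  by (simp add: ker_def)

text \<open>One \<open>\<sigma>\<close> is shared by all components, so that it can be taken out of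
  the series in Green's identity.\<close>

locale triplet_seq =
  fixes H :: "nat \<Rightarrow> 'a::complex_vector hspace" and G :: "nat \<Rightarrow> 'b::complex_vector hspace"
    and S :: "nat \<Rightarrow> ('a \<times> 'a) set" and \<Gamma>0 \<Gamma>1 :: "nat \<Rightarrow> ('a \<times> 'b) set" and \<sigma> :: complex
  assumes triplets: "\<And>n. triplet (H n) (G n) (S n) (\<Gamma>0 n) (\<Gamma>1 n) \<sigma>"
begin

sublocale t: triplet "H n" "G n" "S n" "\<Gamma>0 n" "\<Gamma>1 n" \<sigma> for n
  by (rule triplets)

sublocale H: pre_hilbert_seq H
  by unfold_locales

sublocale G: pre_hilbert_seq G
  by unfold_locales

sublocale B: bounded_operator_seq "\<lambda>n. graph_space (H n) (adj (H n) (S n))" G \<Gamma>0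
proof -
  interpret gr: pre_hilbert_seq "\<lambda>n. graph_space (H n) (adj (H n) (S n))"
    by (rule pre_hilbert_seq.intro) (rule t.pre_hilbert_graph)
  show "bounded_operator_seq (\<lambda>n. graph_space (H n) (adj (H n) (S n))) G \<Gamma>0"
    by unfold_locales (use t.bounded0 t.dom0 in auto)
qed

abbreviation "As \<equiv> adj (hsum H) (op_sum H H S)"
abbreviation "Hp \<equiv> graph_space (hsum H) As"
abbreviation "gr \<equiv> \<lambda>n. graph_space (H n) (adj (H n) (S n))"
abbreviation "\<Gamma>c0 \<equiv> op_sum H G \<Gamma>0 \<restriction> Domain As"
abbreviation "\<Gamma>c1 \<equiv> op_sum H G \<Gamma>1 \<restriction> Domain As"
abbreviation "\<Gamma> \<equiv> {(f, h, h'). (f, h) \<in> \<Gamma>c0 \<and> (f, h') \<in> \<Gamma>c1}"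
abbreviation "At0 \<equiv> op_sum H H (\<lambda>n. adj (H n) (S n) \<restriction> ker (\<Gamma>0 n))"
abbreviation "At1 \<equiv> op_sum H H (\<lambda>n. adj (H n) (S n) \<restriction> ker (\<Gamma>1 n))"
text \<open>The domain of the joint map is spelled out as an intersection: exchanging the two
  boundary maps reorders the pairs in \<open>\<Gamma>\<close>, but changes the intersection only by
  commutativity.\<close>

abbreviation "As0 \<equiv> (As \<restriction> (Domain \<Gamma>c0 \<inter> Domain \<Gamma>c1)) \<restriction> ker \<Gamma>c0"

lemma swap: "triplet_seq H G S \<Gamma>1 \<Gamma>0 (- \<sigma>)"
  by (rule triplet_seq.intro) (rule t.swap)

section \<open>The adjoint of the direct sum and its graph space\<close>

lemma As_eq: "As = op_sum H H (\<lambda>n. adj (H n) (S n))"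
  using linear_operatorD(1)[OF t.S_op(1)] subspace_prodD(1)[OF linear_operatorD(2)[OF t.S_op(1)]]
  by (rule adj_op_sum[OF H.pre_hilbert_seq_axioms])

lemma As_op: "linear_operator (hsum H) (hsum H) As"
  unfolding As_eq by (rule linear_operator_op_sum[OF H.pre_hilbert_seq_axioms H.pre_hilbert_seq_axioms t.T_op])

lemma pre_hilbert_Hp: "pre_hilbert Hp"
  by (rule pre_hilbert_graph_space[OF H.s.pre_hilbert_axioms As_op])

lemma mem_As: "(f, f') \<in> As \<longleftrightarrow> f \<in> carr (hsum H) \<and> f' \<in> carr (hsum H) \<and> (\<forall>n. (f n, f' n) \<in> adj (H n) (S n))"
  unfolding As_eq mem_op_sum ..

lemma nrm_gr_power2: "(f, f') \<in> adj (H n) (S n) \<Longrightarrow> (nrm (gr n) f)\<^sup>2 = (nrm (H n) f)\<^sup>2 + (nrm (H n) f')\<^sup>2"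
  by (simp add: nrm_graph_space[OF H.comp t.T_op])

text \<open>The squared graph norm of a component is the sum of the squared norms of
  \<open>f n\<close> and of its image. Both terms are nonnegative, so the graph norms are square
  summable exactly when \<open>f\<close> and its image are. This identifies the graph space of
  \<open>As\<close> with the Hilbert sum of the component graph spaces.\<close>

lemma carr_hsum_gr: "carr (hsum gr) = Domain As"
proof (intro equalityI subsetI)
  fix f assume f: "f \<in> carr (hsum gr)"
  then have "\<exists>y. (f n, y) \<in> adj (H n) (S n)" for n by (auto simp: mem_carr_hsum)
  then obtain f' where f': "\<And>n. (f n, f' n) \<in> adj (H n) (S n)" by metis
  have "summable (\<lambda>n. (nrm (H n) (f n))\<^sup>2 + (nrm (H n) (f' n))\<^sup>2)"
    using f by (simp add: mem_carr_hsum nrm_gr_power2[OF f'])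
  then have "summable (\<lambda>n. (nrm (H n) (f n))\<^sup>2)" "summable (\<lambda>n. (nrm (H n) (f' n))\<^sup>2)"
    by (auto intro: summable_comparison_test'[where N = 0])
  then have "(f, f') \<in> As" using f' by (auto simp: mem_As mem_carr_hsum t.H.mem_adj)
  then show "f \<in> Domain As" by blast
next
  fix f assume "f \<in> Domain As"
  then obtain f' where f': "(f, f') \<in> As" by blast
  then have "summable (\<lambda>n. (nrm (H n) (f n))\<^sup>2 + (nrm (H n) (f' n))\<^sup>2)"
    by (intro summable_add) (auto simp: mem_As mem_carr_hsum)
  moreover have fT: "(f n, f' n) \<in> adj (H n) (S n)" for n using f' by (simp add: mem_As)
  ultimately show "f \<in> carr (hsum gr)" by (auto simp: mem_carr_hsum nrm_gr_power2[OF fT])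
qed

lemma nrm_Hp: "f \<in> carr Hp \<Longrightarrow> nrm Hp f = nrm (hsum gr) f"
proof -
  assume f: "f \<in> carr Hp"
  then obtain f' where f': "(f, f') \<in> As" by auto
  then have c: "f \<in> carr (hsum H)" "f' \<in> carr (hsum H)" "\<And>n. (f n, f' n) \<in> adj (H n) (S n)" by (auto simp: mem_As)
  have "(\<lambda>n. (nrm (gr n) (f n))\<^sup>2) sums ((nrm (hsum H) f)\<^sup>2 + (nrm (hsum H) f')\<^sup>2)"
    unfolding nrm_gr_power2[OF c(3)] by (intro sums_add H.nrm_hsum_sums c)
  then show ?thesis
    using f by (simp add: nrm_graph_space[OF H.s.pre_hilbert_axioms As_op f'] B.H.nrm_hsum carr_hsum_gr sums_iff)
qed

text \<open>The restriction to the domain of \<open>As\<close> is absorbed into the carrier, so the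
  boundary map of the sum becomes a direct sum of bounded everywhere defined operators.\<close>

lemma op_sum_gr: "op_sum gr G \<Gamma>0 = \<Gamma>c0"
proof -
  have "f \<in> carr (hsum H)" if "f \<in> Domain As" for f using that by (auto simp: mem_As)
  then show ?thesis by (auto simp: mem_op_sum carr_hsum_gr restr_def)
qed

section \<open>Closedness and boundedness of a single boundary map\<close>

lemma \<Gamma>c0_subset: "\<Gamma>c0 \<subseteq> carr Hp \<times> carr (hsum G)"
  by (auto simp: restr_def mem_op_sum)

lemma \<Gamma>c0_op: "linear_operator Hp (hsum G) \<Gamma>c0"
  using B.op_sum_linear linear_operator_cong[of "hsum gr" Hp "hsum G" \<Gamma>c0]
  by (simp add: carr_hsum_gr op_sum_gr)

lemma hclosure_\<Gamma>c0: "hclosure (Hp \<oplus>\<^sub>H hsum G) \<Gamma>c0 = \<Gamma>c0"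
proof -
  have "hclosure (Hp \<oplus>\<^sub>H hsum G) \<Gamma>c0 = hclosure (hsum gr \<oplus>\<^sub>H hsum G) \<Gamma>c0"
  proof (rule hclosure_cong)
    show "nrm (Hp \<oplus>\<^sub>H hsum G) p = nrm (hsum gr \<oplus>\<^sub>H hsum G) p" if "p \<in> carr (Hp \<oplus>\<^sub>H hsum G)" for p
      using that nrm_Hp by (cases p)
        (auto simp: nrm_hprod[OF pre_hilbert_Hp G.s.pre_hilbert_axioms]
          nrm_hprod[OF B.H.s.pre_hilbert_axioms G.s.pre_hilbert_axioms] carr_hsum_gr)
  qed (use \<Gamma>c0_subset in \<open>simp_all add: carr_hsum_gr pre_hilbert_hprod pre_hilbert_Hp G.s.pre_hilbert_axioms\<close>)
  then show ?thesis using B.op_sum_is_closed by (simp add: closed_relation_def hclosed_def op_sum_gr)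
qed

lemma closable_\<Gamma>c0: "closable Hp (hsum G) \<Gamma>c0"
  by (simp add: closable_def rel_closure_def hclosure_\<Gamma>c0 \<Gamma>c0_op)

lemma bounded_\<Gamma>c0_iff: "bounded_operator Hp (hsum G) \<Gamma>c0 \<longleftrightarrow> bounded_operator (hsum gr) (hsum G) (op_sum gr G \<Gamma>0)"
proof -
  have "nrm Hp f = nrm (hsum gr) f" if "(f, h) \<in> \<Gamma>c0" for f h
    using \<Gamma>c0_subset that by (intro nrm_Hp) auto
  then show ?thesis using \<Gamma>c0_op B.op_sum_linear unfolding bounded_operator_def op_sum_gr by fastforce
qed

lemma bounded_iff_sup: "bounded_operator Hp (hsum G) \<Gamma>c0 \<longleftrightarrow> B.norm_sup < \<infinity>"
  using bounded_\<Gamma>c0_iff B.bounded_imp_norm_sup_finite B.norm_sup_finite_imp(2) by blast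

lemma full_iff_sup: "Domain \<Gamma>c0 = carr Hp \<longleftrightarrow> B.norm_sup < \<infinity>"
  using B.full_domain_imp_norm_sup_finite B.norm_sup_finite_imp(1) by (auto simp: op_sum_gr carr_hsum_gr)

text \<open>The statements for the other map are those of the exchanged sequence; they are collected
  here because the joint map needs both halves at once.\<close>

lemma \<Gamma>c1_facts:
  shows \<Gamma>c1_subset: "\<Gamma>c1 \<subseteq> carr Hp \<times> carr (hsum G)"
    and \<Gamma>c1_op: "linear_operator Hp (hsum G) \<Gamma>c1"
    and hclosure_\<Gamma>c1: "hclosure (Hp \<oplus>\<^sub>H hsum G) \<Gamma>c1 = \<Gamma>c1"
    and full1_iff_sup: "Domain \<Gamma>c1 = carr Hp \<longleftrightarrow> (SUP n. op_norm (gr n) (G n) (\<Gamma>1 n)) < \<infinity>"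
proof -
  interpret sw: triplet_seq H G S \<Gamma>1 \<Gamma>0 "- \<sigma>" by (rule swap)
  show "\<Gamma>c1 \<subseteq> carr Hp \<times> carr (hsum G)" by (rule sw.\<Gamma>c0_subset)
  show "linear_operator Hp (hsum G) \<Gamma>c1" by (rule sw.\<Gamma>c0_op)
  show "hclosure (Hp \<oplus>\<^sub>H hsum G) \<Gamma>c1 = \<Gamma>c1" by (rule sw.hclosure_\<Gamma>c0)
  show "Domain \<Gamma>c1 = carr Hp \<longleftrightarrow> (SUP n. op_norm (gr n) (G n) (\<Gamma>1 n)) < \<infinity>" by (rule sw.full_iff_sup)
qed

section \<open>The joint boundary map: density of domain and range, closedness\<close>

lemma \<Gamma>_subset: "\<Gamma> \<subseteq> carr Hp \<times> carr (hsum G \<oplus>\<^sub>H hsum G)"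
  using \<Gamma>c0_subset \<Gamma>c1_subset by auto

lemma subspace_\<Gamma>: "complex_vector.subspace \<Gamma>"
proof (rule subspace_prodI)
  note l0 = subspace_prodD[OF linear_operatorD(2)[OF \<Gamma>c0_op]]
  note l1 = subspace_prodD[OF linear_operatorD(2)[OF \<Gamma>c1_op]]
  show "(0, 0) \<in> \<Gamma>" using l0(1) l1(1) by (simp add: zero_prod_def)
  show "(x + x', y + y') \<in> \<Gamma>" if "(x, y) \<in> \<Gamma>" "(x', y') \<in> \<Gamma>" for x y x' y'
    using that by (cases y; cases y') (auto intro: l0(2) l1(2))
  show "(c *\<^sub>C x, c *\<^sub>C y) \<in> \<Gamma>" if "(x, y) \<in> \<Gamma>" for c x y
    using that by (cases y) (auto simp: scaleC_prod_def intro: l0(4) l1(4))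
qed

lemma single_valued_\<Gamma>: "single_valued \<Gamma>"
  using linear_operatorD(3)[OF \<Gamma>c0_op] linear_operatorD(3)[OF \<Gamma>c1_op]
  by (auto simp: single_valued_def)

lemma mem_\<Gamma>: "(f, h, h') \<in> \<Gamma> \<longleftrightarrow> f \<in> Domain As \<and> h \<in> carr (hsum G) \<and> h' \<in> carr (hsum G) \<and>
    (\<forall>n. (f n, h n) \<in> \<Gamma>0 n \<and> (f n, h' n) \<in> \<Gamma>1 n)"
proof -
  have "f \<in> carr (hsum H)" if "f \<in> Domain As" using that by (auto simp: mem_As)
  then show ?thesis by (auto simp: restr_def mem_op_sum)
qed

lemma trunc_mem_As:
  assumes "\<And>n. (f n, f' n) \<in> adj (H n) (S n)"
  shows "(trunc N f, trunc N f') \<in> As"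
  unfolding As_eq
  by (rule trunc_mem_op_sum[OF H.pre_hilbert_seq_axioms H.pre_hilbert_seq_axioms
        linear_operatorD(1)[OF t.T_op] subspace_prodD(1)[OF linear_operatorD(2)[OF t.T_op]] assms])

text \<open>Nothing is assumed about the growth of \<open>f\<close>, \<open>h\<close>,
  \<open>h'\<close>. Hence solutions picked separately in each component by surjectivity can be
  used, even when they do not form an element of the sum.\<close>

lemma trunc_mem_\<Gamma>:
  assumes "\<And>n. (f n, h n) \<in> \<Gamma>0 n" "\<And>n. (f n, h' n) \<in> \<Gamma>1 n"
  shows "(trunc N f, trunc N h, trunc N h') \<in> \<Gamma>"
proof -
  have "\<exists>y. (f n, y) \<in> adj (H n) (S n)" for n using assms(1)[of n] t.dom0[of n] by blast
  then obtain f' where "\<And>n. (f n, f' n) \<in> adj (H n) (S n)" by metis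
  then have "trunc N f \<in> Domain As" using trunc_mem_As by blast
  moreover have "h n \<in> carr (G n)" "h' n \<in> carr (G n)" for n using assms t.boundary_mem by blast+
  ultimately show ?thesis
    using assms t.boundary_zero unfolding mem_\<Gamma> by (auto simp: G.trunc_mem_carr) (auto simp: trunc_def)
qed

lemma sing_mem_\<Gamma>:
  assumes "(f, f') \<in> adj (H n) (S n)" "(f, h) \<in> \<Gamma>0 n" "(f, h') \<in> \<Gamma>1 n"
  shows "(sing n f, sing n f') \<in> As" "(sing n f, sing n h, sing n h') \<in> \<Gamma>"
proof -
  show A: "(sing n f, sing n f') \<in> As"
    unfolding As_eq
    by (rule sing_mem_op_sum[where T = "\<lambda>n. adj (H n) (S n)", OF H.pre_hilbert_seq_axioms H.pre_hilbert_seq_axioms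
          linear_operatorD(1)[OF t.T_op] subspace_prodD(1)[OF linear_operatorD(2)[OF t.T_op]] assms(1)])
  have "h \<in> carr (G n)" "h' \<in> carr (G n)" using assms t.boundary_mem by blast+
  moreover have "sing n f \<in> Domain As" using A by blast
  ultimately show "(sing n f, sing n h, sing n h') \<in> \<Gamma>"
    using assms(2,3) t.boundary_zero unfolding mem_\<Gamma> by (auto simp: G.sing_mem_carr) (auto simp: sing_def)
qed

text \<open>Graph norm convergence of truncations is ordinary convergence in the Hilbert sum of the
  graph spaces, so the tail estimate there applies.\<close>

lemma dense_Domain_\<Gamma>: "hdense Hp (Domain \<Gamma>)"
proof -
  interpret Hp: pre_hilbert Hp by (rule pre_hilbert_Hp)
  have sub: "Domain \<Gamma> \<subseteq> carr Hp" using \<Gamma>_subset by blast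
  have "carr Hp \<subseteq> hclosure Hp (Domain \<Gamma>)"
  proof
    fix f assume f: "f \<in> carr Hp"
    then obtain f' where f': "(f, f') \<in> As" by auto
    have "\<exists>l l'. (f n, l) \<in> \<Gamma>0 n \<and> (f n, l') \<in> \<Gamma>1 n" for n
      using f' t.boundary_values[of "f n" "f' n" n] by (auto simp: mem_As)
    then obtain h h' where h: "\<And>n. (f n, h n) \<in> \<Gamma>0 n" "\<And>n. (f n, h' n) \<in> \<Gamma>1 n" by metis
    have tr: "trunc N f \<in> Domain \<Gamma>" for N using trunc_mem_\<Gamma>[OF h] by blast
    have "nrm (hsum gr) (f - trunc N f) = nrm Hp (f - trunc N f)" for N
      by (rule nrm_Hp[symmetric]) (use f tr sub in \<open>intro Hp.diff_mem; blast\<close>)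
    then have "(\<lambda>N. nrm Hp (f - trunc N f)) \<longlonglongrightarrow> 0"
      using B.H.trunc_tendsto[of f] f by (simp add: carr_hsum_gr)
    with f tr show "f \<in> hclosure Hp (Domain \<Gamma>)" by (rule Hp.hclosureI_sequentially)
  qed
  then show ?thesis using sub Hp.hclosure_subset unfolding hdense_def by (intro conjI equalityI)
qed

text \<open>Dropping one boundary component of an approximation to \<open>(f, h, h')\<close> gives
  an approximation in the graph of the other map, and both of these graphs are closed.\<close>

lemma closed_\<Gamma>: "closed_relation Hp (hsum G \<oplus>\<^sub>H hsum G) \<Gamma>"
proof -
  interpret Hp: pre_hilbert Hp by (rule pre_hilbert_Hp)
  note GG = pre_hilbert_hprod[OF G.s.pre_hilbert_axioms G.s.pre_hilbert_axioms]
  interpret P: pre_hilbert "Hp \<oplus>\<^sub>H hsum G \<oplus>\<^sub>H hsum G"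
    by (rule pre_hilbert_hprod[OF pre_hilbert_Hp GG])
  show ?thesis unfolding closed_relation_def
  proof (rule P.hclosedI)
    show "hclosure (Hp \<oplus>\<^sub>H hsum G \<oplus>\<^sub>H hsum G) \<Gamma> \<subseteq> \<Gamma>"
    proof
      fix p assume p: "p \<in> hclosure (Hp \<oplus>\<^sub>H hsum G \<oplus>\<^sub>H hsum G) \<Gamma>"
      obtain f h h' where peq: "p = (f, h, h')" by (cases p) auto
      note fh = p[unfolded peq mem_hclosure_hprod[OF pre_hilbert_Hp GG \<Gamma>_subset]]
      have c: "f \<in> carr Hp" "h \<in> carr (hsum G)" "h' \<in> carr (hsum G)" using fh by simp_all
      have approx: "\<exists>a b b'. (a, b, b') \<in> \<Gamma> \<and> nrm Hp (f - a) < e \<and> nrm (hsum G) (h - b) < e \<and> nrm (hsum G) (h' - b') < e"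
        if e: "e > 0" for e
      proof -
        obtain a q where q: "(a, q) \<in> \<Gamma>" "nrm Hp (f - a) < e" "nrm (hsum G \<oplus>\<^sub>H hsum G) ((h, h') - q) < e"
          using fh e by blast
        obtain b b' where qeq: "q = (b, b')" by (cases q)
        have bc: "b \<in> carr (hsum G)" "b' \<in> carr (hsum G)" using q(1) qeq mem_\<Gamma> by blast+
        have "nrm (hsum G \<oplus>\<^sub>H hsum G) (h - b, h' - b') =
            sqrt ((nrm (hsum G) (h - b))\<^sup>2 + (nrm (hsum G) (h' - b'))\<^sup>2)"
          by (rule nrm_hprod[OF G.s.pre_hilbert_axioms G.s.pre_hilbert_axioms
                G.s.diff_mem[OF c(2) bc(1)] G.s.diff_mem[OF c(3) bc(2)]])
        moreover have "nrm (hsum G \<oplus>\<^sub>H hsum G) (h - b, h' - b') < e" using q(3) qeq by simp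
        moreover have "nrm (hsum G) (h - b) \<le> sqrt ((nrm (hsum G) (h - b))\<^sup>2 + (nrm (hsum G) (h' - b'))\<^sup>2)"
          "nrm (hsum G) (h' - b') \<le> sqrt ((nrm (hsum G) (h - b))\<^sup>2 + (nrm (hsum G) (h' - b'))\<^sup>2)"
          by (rule real_le_rsqrt; simp)+
        ultimately have "nrm (hsum G) (h - b) < e" "nrm (hsum G) (h' - b') < e" by linarith+
        then show ?thesis using q(1,2) qeq by blast
      qed
      have "(f, h) \<in> hclosure (Hp \<oplus>\<^sub>H hsum G) \<Gamma>c0"
        unfolding mem_hclosure_hprod[OF pre_hilbert_Hp G.s.pre_hilbert_axioms \<Gamma>c0_subset]
        using c approx by blast
      moreover have "(f, h') \<in> hclosure (Hp \<oplus>\<^sub>H hsum G) \<Gamma>c1"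
        unfolding mem_hclosure_hprod[OF pre_hilbert_Hp G.s.pre_hilbert_axioms \<Gamma>c1_subset]
        using c approx by blast
      ultimately show "p \<in> \<Gamma>" unfolding hclosure_\<Gamma>c0 hclosure_\<Gamma>c1 peq by simp
    qed
  qed (use \<Gamma>_subset in simp)
qed

lemma dense_Range_\<Gamma>: "hdense (hsum G \<oplus>\<^sub>H hsum G) (Range \<Gamma>)"
proof -
  interpret GG: pre_hilbert "hsum G \<oplus>\<^sub>H hsum G"
    by (rule pre_hilbert_hprod[OF G.s.pre_hilbert_axioms G.s.pre_hilbert_axioms])
  have sub: "Range \<Gamma> \<subseteq> carr (hsum G) \<times> carr (hsum G)" using \<Gamma>_subset by auto
  \<comment> \<open>The whole product space is written as a direct sum of full relations, which
    makes density of the range an instance of the truncation argument for relations.\<close>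
  have "op_sum G G (\<lambda>n. carr (G n) \<times> carr (G n)) \<subseteq> rel_closure (hsum G) (hsum G) (Range \<Gamma>)"
  proof (rule op_sum_subset_closure[OF G.pre_hilbert_seq_axioms G.pre_hilbert_seq_axioms subset_refl _ sub])
    fix h h' N assume "(h, h') \<in> op_sum G G (\<lambda>n. carr (G n) \<times> carr (G n))"
    then have "\<exists>f. (f, h n) \<in> \<Gamma>0 n \<and> (f, h' n) \<in> \<Gamma>1 n" for n by (auto simp: mem_op_sum intro: t.surj)
    then obtain f where "\<And>n. (f n, h n) \<in> \<Gamma>0 n" "\<And>n. (f n, h' n) \<in> \<Gamma>1 n" by metis
    from trunc_mem_\<Gamma>[OF this] show "(trunc N h, trunc N h') \<in> Range \<Gamma>" by blast
  qed
  moreover have "op_sum G G (\<lambda>n. carr (G n) \<times> carr (G n)) = carr (hsum G \<oplus>\<^sub>H hsum G)"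
    by (auto simp: mem_op_sum) (auto simp: mem_carr_hsum)
  ultimately have "carr (hsum G \<oplus>\<^sub>H hsum G) \<subseteq> hclosure (hsum G \<oplus>\<^sub>H hsum G) (Range \<Gamma>)"
    unfolding rel_closure_def by simp
  then show ?thesis using sub GG.hclosure_subset unfolding hdense_def carr_hprod by (intro conjI equalityI)
qed

section \<open>Green's identity and maximality for the direct sum\<close>

lemma app_As_restr:
  assumes "(f, f') \<in> As" "f \<in> D"
  shows "app (As \<restriction> D) f = f'"
proof (rule app_eq)
  show "single_valued (As \<restriction> D)"
    using linear_operatorD(3)[OF As_op] by (auto simp: single_valued_def restr_def)
qed (use assms in \<open>auto simp: restr_def\<close>)

text \<open>The component identities are summed; membership in \<open>\<Gamma>\<close>, and not only
  in the domain of \<open>As\<close>, makes the series of boundary terms converge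
  separately.\<close>

lemma green_As:
  assumes "(f, f') \<in> As" "(g, g') \<in> As" "(f, l, l') \<in> \<Gamma>" "(g, h, h') \<in> \<Gamma>"
  shows "ip (hsum H) f' g - ip (hsum H) f g' = \<sigma> * (ip (hsum G) l' h - ip (hsum G) l h')"
proof -
  have c: "f \<in> carr (hsum H)" "f' \<in> carr (hsum H)" "g \<in> carr (hsum H)" "g' \<in> carr (hsum H)"
    "l \<in> carr (hsum G)" "l' \<in> carr (hsum G)" "h \<in> carr (hsum G)" "h' \<in> carr (hsum G)"
    using assms(1,2) assms(3,4)[unfolded mem_\<Gamma>] by (auto simp: mem_As)
  have "ip (H n) (f' n) (g n) - ip (H n) (f n) (g' n)
      = \<sigma> * (ip (G n) (l' n) (h n) - ip (G n) (l n) (h' n))" for n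
    using assms(1,2) assms(3,4)[unfolded mem_\<Gamma>] by (intro t.green) (auto simp: mem_As)
  moreover have "(\<lambda>n. ip (H n) (f' n) (g n) - ip (H n) (f n) (g' n)) sums
      (ip (hsum H) f' g - ip (hsum H) f g')"
    by (intro sums_diff H.ip_hsum_sums c)
  moreover have "(\<lambda>n. \<sigma> * (ip (G n) (l' n) (h n) - ip (G n) (l n) (h' n))) sums
      (\<sigma> * (ip (hsum G) l' h - ip (hsum G) l h'))"
    by (intro sums_mult sums_diff G.ip_hsum_sums c)
  ultimately show ?thesis by (simp add: sums_unique2)
qed

lemma maximal_\<Gamma>:
  assumes c: "g \<in> carr (hsum H)" "g' \<in> carr (hsum H)" "h \<in> carr (hsum G)" "h' \<in> carr (hsum G)"
    and all: "\<And>f f' l l'. (f, f') \<in> As \<Longrightarrow> (f, l, l') \<in> \<Gamma>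
      \<Longrightarrow> ip (hsum H) f' g - ip (hsum H) f g' = \<sigma> * (ip (hsum G) l' h - ip (hsum G) l h')"
  shows "(g, h, h') \<in> \<Gamma>"
proof -
  have cn: "g n \<in> carr (H n)" "g' n \<in> carr (H n)" "h n \<in> carr (G n)" "h' n \<in> carr (G n)" for n
    using c by (auto simp: mem_carr_hsum)
  have comp: "ip (H n) f' (g n) - ip (H n) f (g' n) = \<sigma> * (ip (G n) l' (h n) - ip (G n) l (h' n))"
    if f: "(f, f') \<in> adj (H n) (S n)" "(f, l) \<in> \<Gamma>0 n" "(f, l') \<in> \<Gamma>1 n" for n f f' l l'
  proof -
    have "f \<in> carr (H n)" "f' \<in> carr (H n)" "l \<in> carr (G n)" "l' \<in> carr (G n)"
      using f t.boundary_mem by (auto simp: t.H.mem_adj)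
    then show ?thesis
      using all[OF sing_mem_\<Gamma>[OF f]] by (simp add: H.ip_sing_left G.ip_sing_left cn)
  qed
  have "(g n, g' n) \<in> adj (H n) (S n)" "(g n, h n) \<in> \<Gamma>0 n" "(g n, h' n) \<in> \<Gamma>1 n" for n
    using t.maximal[OF cn comp] by blast+
  then have "(g, g') \<in> As" "\<forall>n. (g n, h n) \<in> \<Gamma>0 n \<and> (g n, h' n) \<in> \<Gamma>1 n" using c by (auto simp: mem_As)
  then show ?thesis unfolding mem_\<Gamma> using c by blast
qed

lemma boundary_relation_\<Gamma>:
  assumes "\<sigma> = 1"
  shows "boundary_relation (hsum H) As (hsum G) \<Gamma>"
  unfolding boundary_relation_def
proof (intro conjI)
  have "Domain As \<subseteq> carr (hsum H)" by (auto simp: mem_As)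
  then show "linear_relation (hsum H) (hsum G \<oplus>\<^sub>H hsum G) \<Gamma>"
    unfolding linear_relation_def
    by (intro conjI subspace_\<Gamma> order_trans[OF \<Gamma>_subset[unfolded carr_graph_space]] Sigma_mono) simp_all
  show dom: "Domain \<Gamma> \<subseteq> Domain As" using \<Gamma>_subset by auto
  show "hdense Hp (Domain \<Gamma>)" by (rule dense_Domain_\<Gamma>)
  have ex: "\<exists>f'. (f, f') \<in> As \<and> app (As \<restriction> Domain \<Gamma>) f = f'" if "(f, l, l') \<in> \<Gamma>" for f l l'
  proof -
    have "f \<in> Domain \<Gamma>" using that by blast
    moreover from subsetD[OF dom this] obtain f' where "(f, f') \<in> As" by (rule DomainE)
    ultimately show ?thesis using app_As_restr[of f f' "Domain \<Gamma>"] by (intro exI[of _ f'] conjI)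
  qed
  show "\<forall>(f, l, l')\<in>\<Gamma>. \<forall>(g, h, h')\<in>\<Gamma>.
      ip (hsum H) (app (As \<restriction> Domain \<Gamma>) f) g - ip (hsum H) f (app (As \<restriction> Domain \<Gamma>) g) =
      ip (hsum G) l' h - ip (hsum G) l h'" (is "\<forall>(f, l, l')\<in>\<Gamma>. \<forall>(g, h, h')\<in>\<Gamma>. ?P f l l' g h h'")
  proof -
    have "?P f l l' g h h'" if m: "(f, l, l') \<in> \<Gamma>" "(g, h, h') \<in> \<Gamma>" for f l l' g h h'
    proof -
      obtain f' where f': "(f, f') \<in> As" "app (As \<restriction> Domain \<Gamma>) f = f'" using ex[OF m(1)] by blast
      obtain g' where g': "(g, g') \<in> As" "app (As \<restriction> Domain \<Gamma>) g = g'" using ex[OF m(2)] by blast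
      show ?thesis unfolding f'(2) g'(2) using green_As[OF f'(1) g'(1) m] assms by simp
    qed
    then show ?thesis by blast
  qed
  show "\<forall>g\<in>carr (hsum H). \<forall>g'\<in>carr (hsum H). \<forall>h\<in>carr (hsum G). \<forall>h'\<in>carr (hsum G).
      (\<forall>(f, l, l')\<in>\<Gamma>. ip (hsum H) (app (As \<restriction> Domain \<Gamma>) f) g - ip (hsum H) f g' =
        ip (hsum G) l' h - ip (hsum G) l h') \<longrightarrow> (g, h, h') \<in> \<Gamma>"
  proof (intro ballI impI)
    fix g g' h h'
    assume c: "g \<in> carr (hsum H)" "g' \<in> carr (hsum H)" "h \<in> carr (hsum G)" "h' \<in> carr (hsum G)"
      and all: "\<forall>(f, l, l')\<in>\<Gamma>. ip (hsum H) (app (As \<restriction> Domain \<Gamma>) f) g - ip (hsum H) f g' =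
        ip (hsum G) l' h - ip (hsum G) l h'"
    show "(g, h, h') \<in> \<Gamma>"
    proof (rule maximal_\<Gamma>[OF c])
      fix f f' l l' assume f: "(f, f') \<in> As" "(f, l, l') \<in> \<Gamma>"
      then have "f \<in> Domain \<Gamma>" by blast
      from app_As_restr[OF f(1) this] bspec[OF all f(2)]
      show "ip (hsum H) f' g - ip (hsum H) f g' = \<sigma> * (ip (hsum G) l' h - ip (hsum G) l h')"
        using assms by simp
    qed
  qed
qed

section \<open>The Weyl function\<close>

lemma relation_weyl_\<Gamma>:
  assumes z: "z \<notin> \<real>"
  shows "relation_weyl As \<Gamma> z = op_sum G G (\<lambda>n. triplet_weyl (H n) (S n) (\<Gamma>0 n) (\<Gamma>1 n) z)"
proof -
  have tw: "(h, h') \<in> triplet_weyl (H n) (S n) (\<Gamma>0 n) (\<Gamma>1 n) z \<longleftrightarrow>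
      (\<exists>f. (f, z *\<^sub>C f) \<in> adj (H n) (S n) \<and> (f, h) \<in> \<Gamma>0 n \<and> (f, h') \<in> \<Gamma>1 n)" for h h' n
    by (auto simp: triplet_weyl_def restr_def eigenspace_def)
  have "(h, h') \<in> relation_weyl As \<Gamma> z \<longleftrightarrow> (\<exists>f. (f, h, h') \<in> \<Gamma> \<and> (f, z *\<^sub>C f) \<in> As)" for h h'
    by (auto simp: relation_weyl_def restr_def[of As])
  also have "(\<exists>f. (f, h, h') \<in> \<Gamma> \<and> (f, z *\<^sub>C f) \<in> As) \<longleftrightarrow>
      (h, h') \<in> op_sum G G (\<lambda>n. triplet_weyl (H n) (S n) (\<Gamma>0 n) (\<Gamma>1 n) z)" for h h'
  proof
    assume "\<exists>f. (f, h, h') \<in> \<Gamma> \<and> (f, z *\<^sub>C f) \<in> As"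
    then show "(h, h') \<in> op_sum G G (\<lambda>n. triplet_weyl (H n) (S n) (\<Gamma>0 n) (\<Gamma>1 n) z)"
      unfolding mem_\<Gamma> mem_As mem_op_sum tw scaleC_fun_def by blast
  next
    assume R: "(h, h') \<in> op_sum G G (\<lambda>n. triplet_weyl (H n) (S n) (\<Gamma>0 n) (\<Gamma>1 n) z)"
    then have hc: "h \<in> carr (hsum G)" "h' \<in> carr (hsum G)" by (auto simp: mem_op_sum)
    have "\<exists>f. (f, z *\<^sub>C f) \<in> adj (H n) (S n) \<and> (f, h n) \<in> \<Gamma>0 n \<and> (f, h' n) \<in> \<Gamma>1 n" for n
      using R unfolding mem_op_sum tw by blast
    then obtain f where f: "\<And>n. (f n, z *\<^sub>C f n) \<in> adj (H n) (S n)" "\<And>n. (f n, h n) \<in> \<Gamma>0 n"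
      "\<And>n. (f n, h' n) \<in> \<Gamma>1 n" by metis
    \<comment> \<open>This is where a nonreal \<open>z\<close> is used: the defect estimate may be
      divided by \<open>cmod (z - cnj z)\<close>, so the component defect elements are dominated by
      their square summable boundary values.\<close>
    have "z \<noteq> cnj z" using z Reals_cnj_iff[of z] by metis
    then have p: "cmod (z - cnj z) > 0" by simp
    have "summable (\<lambda>n. (nrm (H n) (f n))\<^sup>2)"
    proof (rule summable_comparison_test')
      show "summable (\<lambda>n. (cmod \<sigma> / cmod (z - cnj z)) * ((nrm (G n) (h n))\<^sup>2 + (nrm (G n) (h' n))\<^sup>2))"
        using hc by (intro summable_mult summable_add) (auto simp: mem_carr_hsum)
      show "norm ((nrm (H n) (f n))\<^sup>2) \<le>
          (cmod \<sigma> / cmod (z - cnj z)) * ((nrm (G n) (h n))\<^sup>2 + (nrm (G n) (h' n))\<^sup>2)" for n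
        using t.defect_bound[OF f(1) f(2) f(3), of n] p by (simp add: field_simps)
    qed
    then have fc: "f \<in> carr (hsum H)" using f(1) by (auto simp: mem_carr_hsum t.H.mem_adj)
    have "(f, z *\<^sub>C f) \<in> As"
      unfolding mem_As using fc H.s.scale_mem[OF fc, of z] f(1) by (simp add: scaleC_fun_def)
    moreover have "(f, h, h') \<in> \<Gamma>" unfolding mem_\<Gamma> using calculation f hc by blast
    ultimately show "\<exists>f. (f, h, h') \<in> \<Gamma> \<and> (f, z *\<^sub>C f) \<in> As" by blast
  qed
  finally show ?thesis by auto
qed

section \<open>Self-adjointness of the restricted extensions\<close>

lemma mem_At0: "(f, f') \<in> At0 \<longleftrightarrow> (f, f') \<in> As \<and> (\<forall>n. (f n, 0) \<in> \<Gamma>0 n)"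
  unfolding mem_op_sum t.mem_T_ker mem_As by blast

text \<open>The zero boundary value is trivially square summable, so vanishing in every component is
  the same as lying in the kernel of the summed boundary map.\<close>

lemma mem_At0': "(f, f') \<in> At0 \<longleftrightarrow> (f, f') \<in> As \<and> (f, 0) \<in> \<Gamma>c0"
proof -
  have "f \<in> carr (hsum H)" if "(f, f') \<in> As" using that by (auto simp: mem_As)
  then show ?thesis by (simp only: mem_At0 mem_restr) (auto simp: mem_op_sum)
qed

lemma mem_As0: "(f, f') \<in> As0 \<longleftrightarrow> (f, f') \<in> As \<and> (f, 0) \<in> \<Gamma>c0 \<and> f \<in> Domain \<Gamma>c1"
  by (simp only: mem_restr[of _ _ _ "ker \<Gamma>c0"] mem_restr[of _ _ As] mem_ker) blast

text \<open>The source of the crossed indices: the only difference between \<open>As0\<close> and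
  the full sum \<open>At0\<close> is the domain of the other boundary map.\<close>

lemma As0_eq: "As0 = {(f, f') \<in> At0. f \<in> Domain \<Gamma>c1}"
  using mem_As0 mem_At0' by auto

lemma At0_subset: "At0 \<subseteq> carr (hsum H) \<times> carr (hsum H)"
  by (auto simp: mem_op_sum)

lemma adj_At0: "adj (hsum H) At0 = At0"
proof -
  have "adj (hsum H) At0 = op_sum H H (\<lambda>n. adj (H n) (adj (H n) (S n) \<restriction> ker (\<Gamma>0 n)))"
  proof (rule adj_op_sum[OF H.pre_hilbert_seq_axioms])
    show "adj (H n) (S n) \<restriction> ker (\<Gamma>0 n) \<subseteq> carr (H n) \<times> carr (H n)" for n
      by (auto simp: t.mem_T_ker t.H.mem_adj)
    show "(0, 0) \<in> adj (H n) (S n) \<restriction> ker (\<Gamma>0 n)" for n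
      using subspace_prodD(1)[OF linear_operatorD(2)[OF t.T_op]] t.boundary_zero by (simp add: t.mem_T_ker)
  qed
  then show ?thesis by (simp add: t.adj_T_ker)
qed

lemma hclosure_At0: "hclosure (hsum H \<oplus>\<^sub>H hsum H) At0 = At0"
  using H.s.closed_relation_adj[OF At0_subset] by (simp add: adj_At0 closed_relation_def hclosed_def)

lemma trunc_mem_As0:
  assumes "(f, f') \<in> At0" shows "(trunc N f, trunc N f') \<in> As0"
proof -
  have f: "\<And>n. (f n, f' n) \<in> adj (H n) (S n)" "\<And>n. (f n, 0) \<in> \<Gamma>0 n" using assms by (auto simp: mem_At0 mem_As)
  have "\<exists>l'. (f n, l') \<in> \<Gamma>1 n" for n using f(1)[of n] t.dom1[of n] by blast
  then obtain h' where h': "\<And>n. (f n, h' n) \<in> \<Gamma>1 n" by metis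
  have "(trunc N f, trunc N (\<lambda>n. 0), trunc N h') \<in> \<Gamma>" by (rule trunc_mem_\<Gamma>[OF f(2) h'])
  moreover have "trunc N (\<lambda>n. 0) = (0 :: nat \<Rightarrow> 'b)" by (simp add: trunc_def fun_eq_iff)
  ultimately show ?thesis unfolding mem_As0 using trunc_mem_As[OF f(1)] by auto
qed

text \<open>The sum \<open>At0\<close> is closed because it is its own adjoint, and truncating one
  of its elements leaves finitely many values of the other boundary map, which brings it into
  \<open>As0\<close>.\<close>

lemma rel_closure_As0: "rel_closure (hsum H) (hsum H) As0 = At0"
proof (rule equalityI)
  have "hclosure (hsum H \<oplus>\<^sub>H hsum H) As0 \<subseteq> hclosure (hsum H \<oplus>\<^sub>H hsum H) At0"
    by (rule hclosure_mono) (auto simp: As0_eq)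
  then show "rel_closure (hsum H) (hsum H) As0 \<subseteq> At0" by (simp only: rel_closure_def hclosure_At0)
  show "At0 \<subseteq> rel_closure (hsum H) (hsum H) As0"
  proof (rule op_sum_subset_closure[OF H.pre_hilbert_seq_axioms H.pre_hilbert_seq_axioms _ trunc_mem_As0])
    show "adj (H n) (S n) \<restriction> ker (\<Gamma>0 n) \<subseteq> carr (H n) \<times> carr (H n)" for n
      by (auto simp: t.mem_T_ker t.H.mem_adj)
    show "As0 \<subseteq> carr (hsum H) \<times> carr (hsum H)" using At0_subset As0_eq by auto
  qed
qed

lemma As0_op: "linear_operator (hsum H) (hsum H) As0"
proof -
  note l0 = subspace_prodD[OF linear_operatorD(2)[OF \<Gamma>c0_op]]
  note l1 = subspace_prodD[OF linear_operatorD(2)[OF \<Gamma>c1_op]]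
  note lA = subspace_prodD[OF linear_operatorD(2)[OF As_op]]
  have "complex_vector.subspace As0"
  proof (rule subspace_prodI)
    show "(0, 0) \<in> As0" using l0(1) l1(1) lA(1) unfolding mem_As0 by blast
    show "(x + x', y + y') \<in> As0" if "(x, y) \<in> As0" "(x', y') \<in> As0" for x y x' y'
      using that lA(2)[of x y x' y'] l0(2)[of x 0 x' 0] l1(2)[of x _ x' _] unfolding mem_As0 by auto
    show "(c *\<^sub>C x, c *\<^sub>C y) \<in> As0" if "(x, y) \<in> As0" for c x y
      using that lA(4)[of x y c] l0(4)[of x 0 c] l1(4)[of x _ c] unfolding mem_As0 by auto
  qed
  moreover have "As0 \<subseteq> As" by (auto simp: restr_def)
  ultimately show ?thesis
    using linear_operatorD(1,3)[OF As_op] unfolding linear_operator_def linear_relation_def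
    by (meson order_trans single_valued_subset)
qed

text \<open>Finitely supported sequences with entries in the domains of the \<open>S n\<close> are
  already dense, and all their boundary values vanish.\<close>

lemma dense_Domain_As0: "hdense (hsum H) (Domain As0)"
proof -
  have "0 \<in> Domain (S n)" for n
    using subspace_prodD(1)[OF linear_operatorD(2)[OF t.S_op(1)]] by blast
  from H.finite_support_dense[of "\<lambda>n. Domain (S n)", OF t.S_op(2) this]
  have d: "hdense (hsum H) {f. (\<forall>n. f n \<in> Domain (S n)) \<and> (\<exists>N. \<forall>n\<ge>N. f n = 0)}" (is "hdense _ ?F") .
  have "?F \<subseteq> Domain As0"
  proof
    fix f assume f: "f \<in> ?F"
    then obtain N where N: "\<forall>n\<ge>N. f n = 0" by blast
    obtain f' where f': "\<And>n. (f n, f' n) \<in> S n" using f by (auto simp: Domain_iff) metis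
    \<comment> \<open>The element equals its own truncation, so only its image has to be cut off,
      and \<open>trunc_mem_As0\<close> returns the same \<open>f\<close>.\<close>
    have "trunc N f = f" using N by (auto simp: trunc_def fun_eq_iff)
    then have fA: "(f, trunc N f') \<in> As" using trunc_mem_As[of f f' N] f' t.S_op(3) by (metis subsetD)
    have "(f, trunc N f') \<in> At0" unfolding mem_At0 using fA t.boundary_values_S(1)[OF f'] by blast
    from trunc_mem_As0[OF this, of N] show "f \<in> Domain As0" using \<open>trunc N f = f\<close> by auto
  qed
  then have "hclosure (hsum H) ?F \<subseteq> hclosure (hsum H) (Domain As0)" by (rule hclosure_mono)
  moreover have "Domain As0 \<subseteq> carr (hsum H)" using linear_operatorD(1)[OF As0_op] by blast
  ultimately show ?thesis using d H.s.hclosure_subset[of "Domain As0"] unfolding hdense_def by blast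
qed

lemma self_adjoint_At0: "self_adjoint (hsum H) At0"
proof -
  have "As0 \<subseteq> At0" by (auto simp: As0_eq)
  then have "hclosure (hsum H) (Domain As0) \<subseteq> hclosure (hsum H) (Domain At0)"
    by (intro hclosure_mono Domain_mono)
  then have dense: "hdense (hsum H) (Domain At0)"
    using dense_Domain_As0 At0_subset H.s.hclosure_subset[of "Domain At0"] unfolding hdense_def by blast
  from H.s.linear_operator_adj[OF At0_subset this] have "linear_operator (hsum H) (hsum H) At0"
    by (simp only: adj_At0)
  with dense show ?thesis unfolding self_adjoint_def by (simp only: adj_At0)
qed

lemma essentially_self_adjoint_As0: "essentially_self_adjoint (hsum H) As0"
  unfolding essentially_self_adjoint_def rel_closure_As0
  by (intro conjI As0_op dense_Domain_As0 self_adjoint_At0)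

lemma sup_finite_imp_As0_eq:
  assumes "(SUP n. op_norm (gr n) (G n) (\<Gamma>1 n)) < \<infinity>" shows "As0 = At0"
proof -
  have "Domain \<Gamma>c1 = Domain As" using assms full1_iff_sup by simp
  then show ?thesis unfolding As0_eq using mem_At0 by auto
qed

lemma mem_At1_imp: "f \<in> Domain At1 \<Longrightarrow> f \<in> Domain \<Gamma>c1"
proof -
  interpret sw: triplet_seq H G S \<Gamma>1 \<Gamma>0 "- \<sigma>" by (rule swap)
  show "f \<in> Domain At1 \<Longrightarrow> f \<in> Domain \<Gamma>c1" using sw.mem_At0' by blast
qed

text \<open>Transversality enters as the decomposition of the domain of \<open>As\<close>. The
  summands of an element then both lie in the domain of \<open>\<Gamma>c1\<close>, so this domain is
  full and the gliding hump gives the uniform bound.\<close>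

lemma self_adjoint_iff_sup_finite:
  assumes trans: "\<And>f. f \<in> Domain As \<Longrightarrow> \<exists>g\<in>Domain At0. \<exists>h\<in>Domain At1. f = g + h"
  shows "As0 = adj (hsum H) As0 \<longleftrightarrow> (SUP n. op_norm (gr n) (G n) (\<Gamma>1 n)) < \<infinity>"
proof
  assume sa: "As0 = adj (hsum H) As0"
  have "closed_relation (hsum H) (hsum H) As0"
    by (subst sa) (rule H.s.closed_relation_adj[OF linear_operatorD(1)[OF As0_op]])
  \<comment> \<open>An operator equal to its adjoint is closed, hence equal to its closure, which is
    \<open>At0\<close>.\<close>
  then have "As0 = At0" using rel_closure_As0 by (simp add: closed_relation_def hclosed_def rel_closure_def)
  then have At0: "Domain At0 \<subseteq> Domain \<Gamma>c1" unfolding As0_eq by blast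
  have "carr Hp \<subseteq> Domain \<Gamma>c1"
  proof
    fix f assume "f \<in> carr Hp"
    then have "f \<in> Domain As" by simp
    from trans[OF this] obtain g h where gh: "g \<in> Domain At0" "h \<in> Domain At1" "f = g + h" by blast
    then obtain k k' where "(g, k) \<in> \<Gamma>c1" "(h, k') \<in> \<Gamma>c1" using At0 mem_At1_imp by blast
    from subspace_prodD(2)[OF linear_operatorD(2)[OF \<Gamma>c1_op] this] show "f \<in> Domain \<Gamma>c1" using gh(3) by blast
  qed
  then have "Domain \<Gamma>c1 = carr Hp" using \<Gamma>c1_subset by blast
  then show "(SUP n. op_norm (gr n) (G n) (\<Gamma>1 n)) < \<infinity>" using full1_iff_sup by blast
next
  assume "(SUP n. op_norm (gr n) (G n) (\<Gamma>1 n)) < \<infinity>"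
  from sup_finite_imp_As0_eq[OF this] show "As0 = adj (hsum H) As0" using adj_At0 by (simp only:)
qed

end

section \<open>Assembly of the statements for both indices\<close>

theorem theorem3p2:
  fixes \<HH> :: "nat \<Rightarrow> 'a::complex_vector hspace"
    and \<H> :: "nat \<Rightarrow> 'b::complex_vector hspace"
    and S :: "nat \<Rightarrow> ('a \<times> 'a) set"
    and \<Gamma>n :: "nat \<Rightarrow> nat \<Rightarrow> ('a \<times> 'b) set"
  assumes "\<And>n. hilbert_space (\<HH> n)"
    and "\<And>n. closed_symmetric (\<HH> n) (S n)"
    and "\<And>n. equal_deficiency_indices (\<HH> n) (S n)"
    and "\<And>n. boundary_triplet (\<HH> n) (S n) (\<H> n) (\<Gamma>n 0 n) (\<Gamma>n 1 n)"
  defines "HH \<equiv> hsum \<HH>"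
    and "K \<equiv> hsum \<H>"
  defines "A \<equiv> op_sum \<HH> \<HH> S"
  defines "As \<equiv> adj HH A"
  defines "Hp \<equiv> graph_space HH As"
  defines "\<Gamma>c \<equiv> \<lambda>j. op_sum \<HH> \<H> (\<Gamma>n j) \<restriction> Domain As"
  defines "\<Gamma> \<equiv> {(f, h, h'). (f, h) \<in> \<Gamma>c 0 \<and> (f, h') \<in> \<Gamma>c 1}"
  defines "\<Gamma>bar \<equiv> \<lambda>j. rel_closure Hp K (\<Gamma>c j)"
  defines "C \<equiv> \<lambda>j. SUP n. op_norm (graph_space (\<HH> n) (adj (\<HH> n) (S n))) (\<H> n) (\<Gamma>n j n)"
  defines "At \<equiv> \<lambda>j. op_sum \<HH> \<HH> (\<lambda>n. adj (\<HH> n) (S n) \<restriction> ker (\<Gamma>n j n))"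
  defines "Asj \<equiv> \<lambda>j. (As \<restriction> Domain \<Gamma>) \<restriction> ker (\<Gamma>c j)"
  shows
    "(As = op_sum \<HH> \<HH> (\<lambda>n. adj (\<HH> n) (S n))) \<and>
     (boundary_relation HH As K \<Gamma> \<and> single_valued \<Gamma>) \<and>
     (\<forall>z. z \<notin> \<real> \<longrightarrow>
           relation_weyl As \<Gamma> z =
           op_sum \<H> \<H> (\<lambda>n. triplet_weyl (\<HH> n) (S n) (\<Gamma>n 0 n) (\<Gamma>n 1 n) z)) \<and>
     (hdense (K \<oplus>\<^sub>H K) (Range \<Gamma>)) \<and>
     (closed_relation Hp (K \<oplus>\<^sub>H K) \<Gamma> \<and> (\<forall>j\<in>{0, 1}. closable Hp K (\<Gamma>c j))) \<and>
     ((\<forall>j\<in>{0, 1}.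
            (Domain (\<Gamma>bar j) = carr Hp \<longleftrightarrow> bounded_operator Hp K (\<Gamma>bar j)) \<and>
            (bounded_operator Hp K (\<Gamma>bar j) \<longleftrightarrow> C j < \<infinity>)) \<and>
         (Domain \<Gamma> = Domain (\<Gamma>c 0) \<inter> Domain (\<Gamma>c 1) \<and>
          Domain (\<Gamma>c 0) \<inter> Domain (\<Gamma>c 1) = carr Hp \<longleftrightarrow> max (C 0) (C 1) < \<infinity>)) \<and>
     (\<forall>j\<in>{0, 1}. essentially_self_adjoint HH (Asj j) \<and> rel_closure HH HH (Asj j) = At j) \<and>
     (\<forall>j\<in>{0, 1}.
           (C (1 - j) < \<infinity> \<longrightarrow> self_adjoint HH (Asj j) \<and> Asj j = At j) \<and>
           (transversal HH A (At 0) (At 1) \<longrightarrow> (Asj j = adj HH (Asj j) \<longleftrightarrow> C (1 - j) < \<infinity>)))"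
proof -
  have "triplet (\<HH> n) (\<H> n) (S n) (\<Gamma>n 0 n) (\<Gamma>n 1 n) 1" for n
    using assms(1,2,4) by (intro boundary_triplet_imp_triplet hilbert_space_imp_pre_hilbert)
  then interpret t: triplet_seq \<HH> \<H> S "\<Gamma>n 0" "\<Gamma>n 1" 1
    by (rule triplet_seq.intro)
  \<comment> \<open>This instance supplies the case j = 1: its facts with index 0 speak about
    \<open>\<Gamma>n 1\<close>, and the roles of \<open>C 0\<close> and \<open>C 1\<close> are
    exchanged.\<close>
  interpret w: triplet_seq \<HH> \<H> S "\<Gamma>n 1" "\<Gamma>n 0" "- 1"
    by (rule t.swap)
  note defs = HH_def K_def A_def As_def Hp_def \<Gamma>c_def At_def C_def
  have As: "As = op_sum \<HH> \<HH> (\<lambda>n. adj (\<HH> n) (S n))"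
    unfolding defs by (rule t.As_eq)
  have rel: "boundary_relation HH As K \<Gamma>" "single_valued \<Gamma>"
    unfolding defs \<Gamma>_def by (rule t.boundary_relation_\<Gamma>[OF refl], rule t.single_valued_\<Gamma>)
  have weyl: "relation_weyl As \<Gamma> z =
      op_sum \<H> \<H> (\<lambda>n. triplet_weyl (\<HH> n) (S n) (\<Gamma>n 0 n) (\<Gamma>n 1 n) z)" if "z \<notin> \<real>" for z
    unfolding defs \<Gamma>_def by (rule t.relation_weyl_\<Gamma>[OF that])
  have ran: "hdense (K \<oplus>\<^sub>H K) (Range \<Gamma>)"
    unfolding defs \<Gamma>_def by (rule t.dense_Range_\<Gamma>)
  have closed: "closed_relation Hp (K \<oplus>\<^sub>H K) \<Gamma>"
    unfolding defs \<Gamma>_def by (rule t.closed_\<Gamma>)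
  have closable: "closable Hp K (\<Gamma>c 0)" "closable Hp K (\<Gamma>c 1)"
    unfolding defs by (rule t.closable_\<Gamma>c0, rule w.closable_\<Gamma>c0)
  have bar: "\<Gamma>bar 0 = \<Gamma>c 0" "\<Gamma>bar 1 = \<Gamma>c 1"
    unfolding defs \<Gamma>bar_def rel_closure_def by (rule t.hclosure_\<Gamma>c0, rule w.hclosure_\<Gamma>c0)
  have full: "Domain (\<Gamma>c 0) = carr Hp \<longleftrightarrow> C 0 < \<infinity>" "Domain (\<Gamma>c 1) = carr Hp \<longleftrightarrow> C 1 < \<infinity>"
    unfolding defs by (rule t.full_iff_sup, rule w.full_iff_sup)
  have bounded: "bounded_operator Hp K (\<Gamma>c 0) \<longleftrightarrow> C 0 < \<infinity>" "bounded_operator Hp K (\<Gamma>c 1) \<longleftrightarrow> C 1 < \<infinity>"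
    unfolding defs by (rule t.bounded_iff_sup, rule w.bounded_iff_sup)
  have sub: "Domain (\<Gamma>c 0) \<subseteq> carr Hp" "Domain (\<Gamma>c 1) \<subseteq> carr Hp"
    using t.\<Gamma>c0_subset w.\<Gamma>c0_subset unfolding defs by auto
  have dom: "Domain \<Gamma> = Domain (\<Gamma>c 0) \<inter> Domain (\<Gamma>c 1)"
    unfolding \<Gamma>_def by auto
  \<comment> \<open>Each intersection is put in the order of the instance that is applied to it, the
    map whose kernel is taken coming first.\<close>
  then have Asj: "Asj 0 = (As \<restriction> (Domain (\<Gamma>c 0) \<inter> Domain (\<Gamma>c 1))) \<restriction> ker (\<Gamma>c 0)"
      "Asj 1 = (As \<restriction> (Domain (\<Gamma>c 1) \<inter> Domain (\<Gamma>c 0))) \<restriction> ker (\<Gamma>c 1)"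
    unfolding Asj_def by (auto simp only: Int_commute)
  have both: "Domain (\<Gamma>c 0) \<inter> Domain (\<Gamma>c 1) = carr Hp \<longleftrightarrow> max (C 0) (C 1) < \<infinity>"
  proof -
    have "Domain (\<Gamma>c 0) \<inter> Domain (\<Gamma>c 1) = carr Hp \<longleftrightarrow> Domain (\<Gamma>c 0) = carr Hp \<and> Domain (\<Gamma>c 1) = carr Hp"
      using sub by blast
    then show ?thesis by (simp only: full max_less_iff_conj)
  qed
  have ess: "essentially_self_adjoint HH (Asj 0)" "essentially_self_adjoint HH (Asj 1)"
    unfolding Asj defs by (rule t.essentially_self_adjoint_As0, rule w.essentially_self_adjoint_As0)
  have closure: "rel_closure HH HH (Asj 0) = At 0" "rel_closure HH HH (Asj 1) = At 1"
    unfolding Asj defs by (rule t.rel_closure_As0, rule w.rel_closure_As0)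
  have eq: "C 1 < \<infinity> \<Longrightarrow> Asj 0 = At 0" "C 0 < \<infinity> \<Longrightarrow> Asj 1 = At 1"
    unfolding Asj defs by (erule t.sup_finite_imp_As0_eq, erule w.sup_finite_imp_As0_eq)
  have sa: "self_adjoint HH (At 0)" "self_adjoint HH (At 1)"
    unfolding defs by (rule t.self_adjoint_At0, rule w.self_adjoint_At0)
  have trans: "(Asj 0 = adj HH (Asj 0) \<longleftrightarrow> C 1 < \<infinity>) \<and> (Asj 1 = adj HH (Asj 1) \<longleftrightarrow> C 0 < \<infinity>)"
    if tr: "transversal HH A (At 0) (At 1)"
  proof -
    have sum: "\<exists>g\<in>Domain (At 0). \<exists>h\<in>Domain (At 1). f = g + h" if "f \<in> Domain As" for f
    proof -
      have "f \<in> {g + h |g h. g \<in> Domain (At 0) \<and> h \<in> Domain (At 1)}"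
        using tr that unfolding transversal_def As_def by simp
      then show ?thesis by blast
    qed
    \<comment> \<open>The exchanged instance expects the summand from \<open>At 1\<close>
      first.\<close>
    have sum': "\<exists>h\<in>Domain (At 1). \<exists>g\<in>Domain (At 0). f = h + g" if "f \<in> Domain As" for f
      using sum[OF that] by (metis add.commute)
    show ?thesis
      unfolding Asj defs
      by (rule conjI[OF t.self_adjoint_iff_sup_finite[OF sum[unfolded defs]]
            w.self_adjoint_iff_sup_finite[OF sum'[unfolded defs]]])
  qed
  have ball: "(\<forall>j\<in>{0, 1}. P j) \<longleftrightarrow> P 0 \<and> P 1" for P :: "nat \<Rightarrow> bool"
    by simp
  show ?thesis
    unfolding ball bar diff_zero diff_self_eq_0
    using rel weyl ran closed closable full bounded dom both ess closure eq sa trans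
    by (intro conjI allI impI As) (simp_all only: simp_thms)
qed

end
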